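(* Let $n\ge1$ be an integer, $0<\lambda\le\Lambda<+\infty$ and $0<\theta_0<1$. There exist constants $\epsilon_2=\epsilon_2(n,\lambda,\Lambda,\theta_0)>0$, $M=M(n,\lambda,\Lambda)>1$, $0<\Theta=\Theta(n,\lambda,\Lambda)<1$ and $0<\theta=\theta(n,\lambda,\Lambda,\theta_0)<\min\{\theta_0,\Theta\}<1$, each depending only on the indicated quantities, with the following property. Let $0\leq\gamma<1$, $K\geq1$, $f\in C^0(B_1)\cap L^n(B_1)$, and let $u\in C^0(\overline{B_1})$ satisfy $$|Du|^{-\gamma}\mathcal P_{\lambda,\Lambda}^-(D^2u)-|Du|^{1-\gamma}\leq f\quad\text{in } B_1$$ in the viscosity sense. If a ball $B_r(x_0)\subset B_1$ satisfies $$\left|B_r(x_0)\cap T^-_K\cap\{x\in B_1:\mathcal{M}(|f|^n)(x)\leq\epsilon_2 K^{(1-\gamma)n}\}\right|\geq\theta\left|B_r(x_0)\right|,$$ then $$\left|B_r(x_0)\cap T^-_{KM}\right|\geq\Theta\left|B_r(x_0)\right|.$$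
   Context: $B_1$ is the open unit ball of $\mathbb R^n$ centered at the origin, $B_r(x_0)$ is the open ball of radius $r$ and center $x_0$, and $|E|$ denotes Lebesgue measure. For a real symmetric $n\times n$ matrix $X$ with eigenvalues $e_i(X)$, $\mathcal P^-_{\lambda,\Lambda}(X)=\Lambda\sum_{e_i(X)<0}e_i(X)+\lambda\sum_{e_i(X)>0}e_i(X)$. Viscosity sense. $|Du|^{-\gamma}\mathcal P^-_{\lambda,\Lambda}(D^2u)-|Du|^{1-\gamma}\le f$ holds in $B_1$ in the viscosity sense if, for every $\varphi\in C^2(B_1)$ and $x_0\in B_1$ such that $\varphi(x_0)=u(x_0)$ and $\varphi\le u$ in some open neighborhood of $x_0$ in $B_1$, the inequality holds at $x_0$ with $u$ replaced by $\varphi$, i.e. $\mathcal P^-_{\lambda,\Lambda}(D^2\varphi(x_0))-|D\varphi(x_0)|\le |D\varphi(x_0)|^{\gamma}f(x_0)$ (with $|D\varphi(x_0)|^{\gamma}$ read as $1$ when $\gamma=0$). Contact sets. For $\kappa>0$, $T^-_\kappa=T^-_\kappa(u,\overline{B_1})$ is the set of all $x_0\in B_1$ for which there exists $y\in\overline{B_1}$ such that $$u(x_0)+\frac{\kappa}{2}|x_0-y|^2=\inf_{x\in B_1}\left(u(x)+\frac{\kappa}{2}|x-y|^2\right).$$ Maximal function. For $g\in L^1(B_1)$ and $x\in B_1$, $\mathcal M(g)(x)=\sup_{r>0}\frac{1}{|B_r(x)|}\int_{B_r(x)\cap B_1}|g(y)|\,dy$. *)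

theory Defs
  imports "HOL-Analysis.Analysis"
begin

definition eigenspace :: "real^'n^'n \<Rightarrow> real \<Rightarrow> (real^'n) set" where
  "eigenspace X e = {v. X *v v = e *\<^sub>R v}"

definition eigenvalues :: "real^'n^'n \<Rightarrow> real set" where
  "eigenvalues X = {e. \<exists>v. v \<noteq> 0 \<and> X *v v = e *\<^sub>R v}"

text \<open>The minimal Pucci operator, used for symmetric \<open>X\<close>. Each eigenvalue enters with its
  multiplicity, which for a symmetric matrix is the dimension of its eigenspace.\<close>

definition pucci_minus :: "real \<Rightarrow> real \<Rightarrow> real^'n^'n \<Rightarrow> real" where
  "pucci_minus lam Lam X =
     Lam * (\<Sum>e | e \<in> eigenvalues X \<and> e < 0. real (dim (eigenspace X e)) * e)
   + lam * (\<Sum>e | e \<in> eigenvalues X \<and> e > 0. real (dim (eigenspace X e)) * e)"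

definition gradient :: "(real^'n \<Rightarrow> real) \<Rightarrow> real^'n \<Rightarrow> real^'n" where
  "gradient \<phi> x = (\<chi> i. frechet_derivative \<phi> (at x) (axis i 1))"

definition hessian :: "(real^'n \<Rightarrow> real) \<Rightarrow> real^'n \<Rightarrow> real^'n^'n" where
  "hessian \<phi> x = jacobian (gradient \<phi>) (at x)"

text \<open>Intended for open \<open>S\<close>; the values of \<open>\<phi>\<close> outside \<open>S\<close> are then irrelevant.\<close>

definition C2_on :: "(real^'n) set \<Rightarrow> (real^'n \<Rightarrow> real) \<Rightarrow> bool" where
  "C2_on S \<phi> \<longleftrightarrow>
     (\<forall>x\<in>S. \<phi> differentiable (at x)) \<and>
     (\<forall>x\<in>S. gradient \<phi> differentiable (at x)) \<and>
     continuous_on S (hessian \<phi>)"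

text \<open>\<open>|p|^\<gamma>\<close> read as \<open>1\<close> for \<open>\<gamma> = 0\<close>, also at \<open>p = 0\<close>, where \<open>0 powr 0 = 0\<close>.\<close>

definition norm_pow :: "real^'n \<Rightarrow> real \<Rightarrow> real" where
  "norm_pow p \<gamma> = (if \<gamma> = 0 then 1 else norm p powr \<gamma>)"

text \<open>\<open>u\<close> satisfies \<open>|Du|^(-\<gamma>) P(D\<^sup>2u) - |Du|^(1-\<gamma>) \<le> f\<close> in the open unit ball in the viscosity
  sense; the inequality for the test function is multiplied through by \<open>|D\<phi>|^\<gamma>\<close>.\<close>

definition viscosity_supersol ::
  "real \<Rightarrow> real \<Rightarrow> real \<Rightarrow> (real^'n \<Rightarrow> real) \<Rightarrow> (real^'n \<Rightarrow> real) \<Rightarrow> bool" where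
  "viscosity_supersol lam Lam \<gamma> f u \<longleftrightarrow>
     (\<forall>\<phi>. \<forall>x0 \<in> ball 0 1.
        C2_on (ball 0 1) \<phi> \<longrightarrow> \<phi> x0 = u x0 \<longrightarrow>
        (\<exists>U. open U \<and> x0 \<in> U \<and> U \<subseteq> ball 0 1 \<and> (\<forall>x\<in>U. \<phi> x \<le> u x)) \<longrightarrow>
        pucci_minus lam Lam (hessian \<phi> x0) - norm (gradient \<phi> x0)
          \<le> norm_pow (gradient \<phi> x0) \<gamma> * f x0)"

text \<open>The set \<open>T\<^sup>-\<^sub>\<kappa>\<close> of points where \<open>u\<close> is touched from below by a concave paraboloid of opening
  \<open>\<kappa>\<close> with vertex in the closed unit ball. The real infimum is meaningful when \<open>u\<close> is bounded
  below on the unit ball, in particular when \<open>u\<close> is continuous on its closure.\<close>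

definition contact_set :: "real \<Rightarrow> (real^'n \<Rightarrow> real) \<Rightarrow> (real^'n) set" where
  "contact_set \<kappa> u = {x0 \<in> ball 0 1. \<exists>y \<in> cball 0 1.
     u x0 + \<kappa> / 2 * (norm (x0 - y))\<^sup>2 = (INF x \<in> ball 0 1. u x + \<kappa> / 2 * (norm (x - y))\<^sup>2)}"

text \<open>Extended-valued, since the supremum may be infinite at some points.\<close>

definition maximal_fun :: "(real^'n \<Rightarrow> real) \<Rightarrow> real^'n \<Rightarrow> ennreal" where
  "maximal_fun g x = (SUP r \<in> {0<..}.
     (\<integral>\<^sup>+ y \<in> ball x r \<inter> ball 0 1. ennreal \<bar>g y\<bar> \<partial>lebesgue) / emeasure lebesgue (ball x r))"

end

theory Submission
  imports Defs
begin

text \<open>The proof is an Alexandrov-Bakelman-Pucci argument with sliding paraboloids, used twice.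

  \<^emph>\<open>The area estimate.\<close> Slide paraboloids of opening \<open>\<kappa>\<close> with vertices in a set \<open>Y\<close> from below until they touch
  \<open>u\<close> minus a semiconvex function \<open>G\<close>. The vertex is a locally Lipschitz function of the
  contact point, with constant of order \<open>1 + \<kappa>\<^sup>\<gamma>\<^sup>-\<^sup>1 |f|\<close>, because otherwise a quadratic that is
  strongly convex in one direction would touch \<open>u\<close> from below where the equation forbids it (\<open>touching_vertices_close\<close>). A covering
  by small cubes turns this into \<open>|Y| \<le> C \<integral> (1 + \<kappa>\<^sup>\<gamma>\<^sup>-\<^sup>1 |f|)\<^sup>n\<close>, integrated over the contact points
  (\<open>emeasure_vertices_le\<close>). Working with pairs of contact points directly avoids regularising \<open>u\<close>,
  Alexandrov's theorem and the area formula, and all test functions are quadratic with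
  Hessian \<open>\<alpha> I + \<beta> e \<otimes> e\<close>, so the Pucci operator is only evaluated on such matrices.

  \<^emph>\<open>From the boundary to the centre.\<close> Since a fraction \<open>\<theta>\<close> of the ball \<open>B\<close> of radius \<open>r\<close> around \<open>x0\<close>
  consists of good points, one of them, \<open>x1\<close>, has
  distance at least a multiple of \<open>\<theta> r\<close> from the boundary of \<open>B\<close>. Because the maximal function is
  small at \<open>x1\<close>, \<open>\<integral>\<^sub>B |f|\<^sup>n\<close> is small. Add an exponential barrier to the paraboloid touching at
  \<open>x1\<close>. In the outer half of \<open>B\<close> contact with the sum is only possible where \<open>|f|\<close> is large, and
  the area estimate shows that they cannot account for all vertices. So \<open>u\<close> is touched at some \<open>x2\<close> in the
  concentric closed ball of half the radius by a paraboloid whose opening is a fixed multiple of \<open>K\<close>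
  (\<open>contact_point_or_large_source\<close>). The depth of \<open>x1\<close> only affects how small \<open>\<epsilon>2\<close> has to
  be; the opening depends on the barrier, and that only depends on \<open>n\<close>, \<open>\<lambda>\<close> and \<open>\<Lambda>\<close>.

  \<^emph>\<open>From a point to positive density.\<close> Sliding paraboloids with vertices near \<open>x2\<close> below \<open>u\<close> minus the paraboloid
  touching at \<open>x2\<close> keeps all contact points in \<open>B\<close>, and the area estimate bounds their
  measure from below by a multiple of \<open>r\<^sup>n\<close> (\<open>contact_set_density\<close>).\<close>

section \<open>Quadratic test functions\<close>

lemma one_le_card: "1 \<le> real CARD('n::finite)"
  using zero_less_card_finite[where 'a='n] by (simp add: Suc_le_eq)

lemma quadratic_calculus:
  fixes p e \<xi> :: "real^'n" and c \<alpha> \<beta> :: real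
  defines "\<phi> \<equiv> \<lambda>x. c + p \<bullet> (x - \<xi>) + \<alpha> / 2 * (norm (x - \<xi>))\<^sup>2 + \<beta> / 2 * (e \<bullet> (x - \<xi>))\<^sup>2"
  shows "C2_on S \<phi>" and "gradient \<phi> \<xi> = p"
    and "hessian \<phi> \<xi> *v h = \<alpha> *\<^sub>R h + (\<beta> * (e \<bullet> h)) *\<^sub>R e"
proof -
  define g where "g = (\<lambda>x. p + \<alpha> *\<^sub>R (x - \<xi>) + (\<beta> * (e \<bullet> (x - \<xi>))) *\<^sub>R e)"
  define H where "H = (\<lambda>h. \<alpha> *\<^sub>R h + (\<beta> * (e \<bullet> h)) *\<^sub>R e)"
  have d\<phi>: "(\<phi> has_derivative (\<lambda>h. g x \<bullet> h)) (at x)" for x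
    unfolding \<phi>_def g_def power2_norm_eq_inner
    by (auto intro!: derivative_eq_intros simp: algebra_simps inner_simps inner_commute power2_eq_square)
  have g: "gradient \<phi> = g"
  proof
    fix x
    have "frechet_derivative \<phi> (at x) = (\<lambda>h. g x \<bullet> h)"
      using frechet_derivative_at[OF d\<phi>] by simp
    then show "gradient \<phi> x = g x"
      by (simp add: gradient_def vec_eq_iff inner_axis)
  qed
  have dg: "(g has_derivative H) (at x)" for x
    unfolding g_def H_def by (auto intro!: derivative_eq_intros)
  have H: "frechet_derivative g (at x) = H" for x
    using frechet_derivative_at[OF dg] by simp
  have "hessian \<phi> = (\<lambda>x. matrix H)"
    by (simp add: fun_eq_iff hessian_def jacobian_def g H)
  moreover have "matrix H *v h = H h" for h
    using has_derivative_linear[OF dg] by (simp add: matrix_works)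
  ultimately show "C2_on S \<phi>" "hessian \<phi> \<xi> *v h = \<alpha> *\<^sub>R h + (\<beta> * (e \<bullet> h)) *\<^sub>R e"
    using d\<phi> dg g by (auto simp: C2_on_def differentiable_def H_def)
  show "gradient \<phi> \<xi> = p" by (simp add: g g_def)
qed

text \<open>A matrix \<open>\<alpha> I + \<beta> e \<otimes> e\<close> with \<open>|e| = 1\<close> has at most the two eigenvalues \<open>\<alpha>\<close> and
  \<open>\<alpha> + \<beta>\<close>, so its Pucci operator can be bounded directly from the definition. With the
  generous factor \<open>3\<close> the same inequality covers both signs of \<open>\<alpha> + \<beta>\<close>.\<close>

lemma pucci_minus_rank_one_lower:
  fixes X :: "real^'n^'n" and e :: "real^'n"
  assumes X: "\<And>h. X *v h = \<alpha> *\<^sub>R h + (\<beta> * (e \<bullet> h)) *\<^sub>R e"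
    and e: "norm e = 1" and "\<alpha> \<le> 0" "0 \<le> \<beta>" and lam: "0 < lam" "lam \<le> Lam"
  shows "lam * \<beta> + 3 * Lam * real CARD('n) * \<alpha> \<le> pucci_minus lam Lam X"
proof -
  let ?n = "real CARD('n)"
  let ?D = "\<lambda>\<mu>. real (dim (eigenspace X \<mu>))"
  have ee: "e \<bullet> e = 1" using e by (simp add: norm_eq_1)
  have eig: "eigenvalues X \<subseteq> {\<alpha>, \<alpha> + \<beta>}"
  proof
    fix \<mu> assume "\<mu> \<in> eigenvalues X"
    then obtain v where v: "v \<noteq> 0" "\<alpha> *\<^sub>R v + (\<beta> * (e \<bullet> v)) *\<^sub>R e = \<mu> *\<^sub>R v"
      by (auto simp: eigenvalues_def X)
    show "\<mu> \<in> {\<alpha>, \<alpha> + \<beta>}"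
    proof (cases "e \<bullet> v = 0")
      case True then show ?thesis using v by simp
    next
      case False
      have "e \<bullet> (\<alpha> *\<^sub>R v + (\<beta> * (e \<bullet> v)) *\<^sub>R e) = e \<bullet> (\<mu> *\<^sub>R v)"
        using v by simp
      then have "(\<alpha> + \<beta> - \<mu>) * (e \<bullet> v) = 0"
        using ee by (simp add: inner_simps algebra_simps)
      then show ?thesis using False by auto
    qed
  qed
  have fin: "finite {\<mu> \<in> eigenvalues X. P \<mu>}" for P
    by (rule finite_subset[of _ "{\<alpha>, \<alpha> + \<beta>}"]) (use eig in auto)
  have D: "0 \<le> ?D \<mu>" "?D \<mu> \<le> ?n" for \<mu>
    using dim_subset_UNIV[of "eigenspace X \<mu>"] by simp_all
  have n1: "1 \<le> ?n" by (rule one_le_card)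
  have n\<alpha>: "?n * \<alpha> \<le> ?D \<mu> * \<mu>" if "\<mu> \<in> {\<alpha>, \<alpha> + \<beta>}" "\<mu> < 0" for \<mu>
  proof -
    have "?n * \<alpha> \<le> ?D \<mu> * \<alpha>" using D assms by (intro mult_right_mono_neg) auto
    also have "\<dots> \<le> ?D \<mu> * \<mu>" using that assms by (intro mult_left_mono) auto
    finally show ?thesis .
  qed
  have l\<alpha>: "Lam * (?n * \<alpha>) \<le> lam * \<alpha>"
  proof -
    have "lam * 1 \<le> Lam * ?n" using lam n1 by (intro mult_mono) auto
    then show ?thesis using \<open>\<alpha> \<le> 0\<close> mult_right_mono_neg[of "lam" "Lam * ?n" \<alpha>] by (simp add: mult.assoc)
  qed
  have L: "Lam * (?n * \<alpha>) \<le> 0" using lam \<open>\<alpha> \<le> 0\<close> by (simp add: mult_nonneg_nonpos)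
  show ?thesis
  proof (cases "\<alpha> + \<beta> > 0")
    case True
    have mem: "e \<in> eigenspace X (\<alpha> + \<beta>)"
      using ee by (simp add: eigenspace_def X algebra_simps)
    have "e \<noteq> 0" using e by auto
    then have "dim (eigenspace X (\<alpha> + \<beta>)) \<noteq> 0"
      using mem by (auto simp: dim_eq_0)
    then have D1: "1 \<le> ?D (\<alpha> + \<beta>)" by (simp del: dim_eq_0 add: Suc_le_eq)
    have "\<alpha> + \<beta> \<in> eigenvalues X"
      using mem \<open>e \<noteq> 0\<close> by (auto simp: eigenvalues_def eigenspace_def)
    then have "{\<mu> \<in> eigenvalues X. 0 < \<mu>} = {\<alpha> + \<beta>}" using eig True assms(3) by auto
    moreover have "\<alpha> + \<beta> \<le> ?D (\<alpha> + \<beta>) * (\<alpha> + \<beta>)"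
      using mult_right_mono[OF D1, of "\<alpha> + \<beta>"] True by simp
    ultimately have pos: "\<alpha> + \<beta> \<le> (\<Sum>\<mu> | \<mu> \<in> eigenvalues X \<and> 0 < \<mu>. ?D \<mu> * \<mu>)"
      by simp
    have neg: "?n * \<alpha> \<le> (\<Sum>\<mu> | \<mu> \<in> eigenvalues X \<and> \<mu> < 0. ?D \<mu> * \<mu>)"
    proof (cases "\<alpha> \<in> eigenvalues X \<and> \<alpha> < 0")
      case True
      have "{\<mu>. \<mu> \<in> eigenvalues X \<and> \<mu> < 0} \<subseteq> {\<alpha>}"
        using eig \<open>0 < \<alpha> + \<beta>\<close> by auto
      then have "{\<mu>. \<mu> \<in> eigenvalues X \<and> \<mu> < 0} = {\<alpha>}" using True by blast
      then show ?thesis using n\<alpha>[of \<alpha>] True by simp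
    next
      case False
      then have "{\<mu>. \<mu> \<in> eigenvalues X \<and> \<mu> < 0} = {}"
        using eig \<open>0 < \<alpha> + \<beta>\<close> by force
      then have "(\<Sum>\<mu> | \<mu> \<in> eigenvalues X \<and> \<mu> < 0. ?D \<mu> * \<mu>) = 0"
        by (simp only: sum.empty)
      then show ?thesis using \<open>\<alpha> \<le> 0\<close> by (simp add: mult_nonneg_nonpos)
    qed
    have "lam * (\<alpha> + \<beta>) + Lam * (?n * \<alpha>) \<le> pucci_minus lam Lam X"
      unfolding pucci_minus_def using lam
        mult_left_mono[OF pos, of lam] mult_left_mono[OF neg, of Lam] by linarith
    then show ?thesis using l\<alpha> L by (simp add: algebra_simps)
  next
    case False
    let ?N = "{\<mu> \<in> eigenvalues X. \<mu> < 0}"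
    have cN: "card ?N \<le> 2"
    proof -
      have "card ?N \<le> card {\<alpha>, \<alpha> + \<beta>}" by (rule card_mono) (use eig in auto)
      also have "\<dots> \<le> 2" by (simp add: card_insert_if)
      finally show ?thesis .
    qed
    have "2 * (?n * \<alpha>) \<le> real (card ?N) * (?n * \<alpha>)"
      using cN \<open>\<alpha> \<le> 0\<close> by (intro mult_right_mono_neg) (auto simp: mult_nonneg_nonpos)
    also have "\<dots> \<le> (\<Sum>\<mu>\<in>?N. ?D \<mu> * \<mu>)"
      by (rule sum_bounded_below) (use n\<alpha> eig in auto)
    finally have neg: "2 * (?n * \<alpha>) \<le> (\<Sum>\<mu> | \<mu> \<in> eigenvalues X \<and> \<mu> < 0. ?D \<mu> * \<mu>)"
      by simp
    have pos: "0 \<le> (\<Sum>\<mu> | \<mu> \<in> eigenvalues X \<and> 0 < \<mu>. ?D \<mu> * \<mu>)"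
      by (rule sum_nonneg) auto
    have "Lam * (2 * (?n * \<alpha>)) + lam * 0 \<le> pucci_minus lam Lam X"
      unfolding pucci_minus_def using lam
        mult_left_mono[OF pos, of lam] mult_left_mono[OF neg, of Lam] by linarith
    moreover have "lam * \<beta> \<le> - (lam * \<alpha>)"
      using False lam mult_left_mono[of \<beta> "-\<alpha>" lam] by simp
    ultimately show ?thesis using l\<alpha> by (simp add: algebra_simps)
  qed
qed

text \<open>Every test function below is a quadratic polynomial whose Hessian is a rank one perturbation of
  a multiple of the identity. For these the viscosity condition becomes an inequality between
  numbers, which replaces the spectral theory of general symmetric matrices.\<close>

lemma viscosity_quadratic_test:
  fixes u :: "real^'n \<Rightarrow> real"
  assumes vis: "viscosity_supersol lam Lam \<gamma> f u" and lam: "0 < lam" "lam \<le> Lam"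
    and e: "norm e = 1" and ab: "\<alpha> \<le> 0" "0 \<le> \<beta>"
    and S: "open S" "\<xi> \<in> S" "S \<subseteq> ball 0 1"
    and le: "\<And>x. x \<in> S \<Longrightarrow>
      u \<xi> + p \<bullet> (x - \<xi>) + \<alpha> / 2 * (norm (x - \<xi>))\<^sup>2 + \<beta> / 2 * (e \<bullet> (x - \<xi>))\<^sup>2 \<le> u x"
  shows "lam * \<beta> + 3 * Lam * real CARD('n) * \<alpha> \<le> norm p + norm_pow p \<gamma> * f \<xi>"
proof -
  define \<phi> where "\<phi> = (\<lambda>x. u \<xi> + p \<bullet> (x - \<xi>) + \<alpha> / 2 * (norm (x - \<xi>))\<^sup>2 + \<beta> / 2 * (e \<bullet> (x - \<xi>))\<^sup>2)"
  note q = quadratic_calculus[where c = "u \<xi>" and p = p and \<xi> = \<xi> and \<alpha> = \<alpha> and \<beta> = \<beta> and e = e,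
      folded \<phi>_def]
  have "lam * \<beta> + 3 * Lam * real CARD('n) * \<alpha> \<le> pucci_minus lam Lam (hessian \<phi> \<xi>)"
    by (rule pucci_minus_rank_one_lower) (use q(3) e ab lam in auto)
  moreover have "pucci_minus lam Lam (hessian \<phi> \<xi>) - norm (gradient \<phi> \<xi>) \<le> norm_pow (gradient \<phi> \<xi>) \<gamma> * f \<xi>"
  proof (rule vis[unfolded viscosity_supersol_def, rule_format])
    show "\<xi> \<in> ball 0 1" "C2_on (ball 0 1) \<phi>" "\<phi> \<xi> = u \<xi>"
      using S q(1) by (auto simp: \<phi>_def)
    show "\<exists>U. open U \<and> \<xi> \<in> U \<and> U \<subseteq> ball 0 1 \<and> (\<forall>x\<in>U. \<phi> x \<le> u x)"
      using S le unfolding \<phi>_def by blast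
  qed
  ultimately show ?thesis by (simp add: q(2))
qed

section \<open>Lipschitz dependence of the vertex on the contact point\<close>

text \<open>The geometric core of the area estimate. Let paraboloids of opening \<open>\<kappa>\<close> with vertices \<open>y1\<close>, \<open>y2\<close>
  touch \<open>u - G\<close> from below at \<open>x1\<close>, \<open>x2\<close>, where \<open>G\<close> is semiconvex. Adding the first paraboloid to
  \<open>u - G\<close> yields a function \<open>V \<ge> 0\<close> with \<open>V x1 = 0\<close>, and the second contact forces \<open>V\<close> to lie
  above an affine function of slope \<open>\<kappa> |y1 - y2|\<close> that is not far below \<open>0\<close> near \<open>x1\<close>.
  So \<open>V\<close> bends upwards in the direction of \<open>y2 - y1\<close>, the more so the larger this slope is compared
  with \<open>|x1 - x2|\<close>, and it is touched from below by a quadratic with a correspondingly large second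
  derivative in that direction, which the equation bounds by \<open>f\<close>. Hence the vertex is a
  Lipschitz function of the contact point, with a constant controlled by \<open>f\<close>. The number \<open>d\<close> may
  exceed \<open>|x1 - x2|\<close>, so the estimate for \<open>x1 = x2\<close> also shows that a contact point has only one
  vertex.\<close>

lemma touching_vertices_close:
  fixes lam Lam :: real and u G :: "real^'n \<Rightarrow> real" and g :: "real^'n \<Rightarrow> real^'n"
  defines "N \<equiv> real CARD('n)"
  defines "R \<equiv> 10 * (Lam * N / lam)"
  assumes vis: "viscosity_supersol lam Lam \<gamma> f u" and lam: "0 < lam" "lam \<le> Lam"
    and S: "open S" "S \<subseteq> ball 0 1" and uc: "continuous_on S u" and Gc: "continuous_on S G"
    and semi: "\<And>x \<xi>. x \<in> S \<Longrightarrow> \<xi> \<in> S \<Longrightarrow> G \<xi> + g \<xi> \<bullet> (x - \<xi>) - c / 2 * (norm (x - \<xi>))\<^sup>2 \<le> G x"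
    and slope: "\<And>\<xi>. \<xi> \<in> S \<Longrightarrow> norm (g \<xi>) \<le> c" and c: "0 \<le> c" and \<kappa>: "0 < \<kappa>"
    and t1: "\<And>x. x \<in> S \<Longrightarrow> u x1 - G x1 + \<kappa> / 2 * (norm (x1 - y1))\<^sup>2 \<le> u x - G x + \<kappa> / 2 * (norm (x - y1))\<^sup>2"
    and t2: "\<And>x. x \<in> S \<Longrightarrow> u x2 - G x2 + \<kappa> / 2 * (norm (x2 - y2))\<^sup>2 \<le> u x - G x + \<kappa> / 2 * (norm (x - y2))\<^sup>2"
    and xS: "x1 \<in> S" "x2 \<in> S" and far: "\<And>x. x \<in> S \<Longrightarrow> norm (x - y1) \<le> 2" "norm (y1 - y2) \<le> 2"
    and d: "0 < d" "norm (x1 - x2) \<le> d" "cball x1 (R * d) \<subseteq> S"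
  obtains \<xi> and p :: "real^'n" where "\<xi> \<in> cball x1 (R * d)" "norm p \<le> c + 4 * \<kappa>"
    "norm (y1 - y2) \<le> d * (16 / (lam * \<kappa>) * (3 * Lam * N * (c + \<kappa>) + norm p + norm_pow p \<gamma> * \<bar>f \<xi>\<bar>))"
proof (cases "y1 = y2")
  case True
  have N1: "1 \<le> N" unfolding N_def by (rule one_le_card)
  have "0 \<le> norm_pow (0::real^'n) \<gamma>" by (simp add: norm_pow_def)
  moreover have "0 \<le> R" using lam N1 by (simp add: R_def)
  ultimately have "x1 \<in> cball x1 (R * d)" "norm (0::real^'n) \<le> c + 4 * \<kappa>"
    "norm (y1 - y2) \<le> d * (16 / (lam * \<kappa>) * (3 * Lam * N * (c + \<kappa>) + norm (0::real^'n) + norm_pow (0::real^'n) \<gamma> * \<bar>f x1\<bar>))"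
    using True lam c \<kappa> d N1 by (auto intro!: mult_nonneg_nonneg add_nonneg_nonneg divide_nonneg_nonneg)
  then show ?thesis by (rule that)
next
  case False
  define q where "q = \<kappa> *\<^sub>R (y2 - y1)"
  define m where "m = norm q"
  define e where "e = (1 / m) *\<^sub>R q"
  have mn: "m = \<kappa> * norm (y1 - y2)"
    unfolding m_def q_def norm_scaleR norm_minus_commute[of y2] using \<kappa> by simp
  have m: "0 < m" unfolding mn using False \<kappa> by simp
  have e: "norm e = 1" "q = m *\<^sub>R e" using m by (auto simp: e_def m_def)
  have N1: "1 \<le> N" unfolding N_def by (rule one_le_card)
  have rat: "1 \<le> Lam * N / lam"
    using mult_mono[of lam Lam 1 N] lam N1 by (simp add: field_simps)
  have R: "10 \<le> R" "100 * (Lam * N / lam) \<le> R\<^sup>2"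
  proof -
    show "10 \<le> R" using rat by (simp add: R_def)
    have "Lam * N / lam * 1 \<le> Lam * N / lam * (Lam * N / lam)" using rat by (intro mult_left_mono) auto
    then show "100 * (Lam * N / lam) \<le> R\<^sup>2" by (simp add: R_def power2_eq_square)
  qed
  define V where "V x = u x - G x + \<kappa> / 2 * (norm (x - y1))\<^sup>2 - (u x1 - G x1 + \<kappa> / 2 * (norm (x1 - y1))\<^sup>2)" for x
  have V0: "0 \<le> V x" if "x \<in> S" for x using t1[OF that] by (simp add: V_def)
  have V1: "V x1 = 0" by (simp add: V_def)
  have Vm: "m * (e \<bullet> (x - x1) - d) \<le> V x" if "x \<in> S" for x
  proof -
    \<comment> \<open>Both contact conditions are compared at \<open>x2\<close>; the quadratic terms cancel and leave an affine function.\<close>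
    have id: "\<kappa> / 2 * (norm (x - y1))\<^sup>2 - \<kappa> / 2 * (norm (x - y2))\<^sup>2 - \<kappa> / 2 * (norm (x2 - y1))\<^sup>2
        + \<kappa> / 2 * (norm (x2 - y2))\<^sup>2 = q \<bullet> (x - x2)"
      by (simp add: q_def power2_norm_eq_inner inner_simps inner_commute algebra_simps)
    have "e \<bullet> (x2 - x1) \<le> norm e * norm (x2 - x1)" by (rule norm_cauchy_schwarz)
    also have "\<dots> \<le> d" using d e by (simp add: norm_minus_commute)
    finally have "m * (e \<bullet> (x - x1) - d) \<le> m * (e \<bullet> (x - x1) - e \<bullet> (x2 - x1))"
      using m by simp
    also have "\<dots> = q \<bullet> (x - x2)" by (simp add: e inner_simps algebra_simps)
    also have "\<dots> \<le> V x" using id t2[OF that] t1[OF xS(2)] unfolding V_def by linarith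
    finally show ?thesis .
  qed
  define t where "t x = e \<bullet> (x - x1)" for x
  \<comment> \<open>\<open>Q\<close> exceeds \<open>V\<close> at \<open>x1\<close>, but on the boundary of the slab \<open>|t| \<le> 2 d\<close> inside the ball of radius
    \<open>R d\<close> it is at most the larger of \<open>0\<close> and \<open>m (t - d)\<close>, and so at most \<open>V\<close>. Hence \<open>V - Q\<close> has
    an interior minimum.\<close>
  define Q where "Q x = m / (16 * d) * (t x + 2 * d)\<^sup>2 - m / (R\<^sup>2 * d) * (norm (x - x1))\<^sup>2" for x
  define S0 where "S0 = cball x1 (R * d) \<inter> {x. \<bar>t x\<bar> \<le> 2 * d}"
  have tc: "continuous_on T t" for T unfolding t_def by (intro continuous_intros)
  have "closed {x. \<bar>t x\<bar> \<le> 2 * d}" by (intro closed_Collect_le continuous_intros tc)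
  then have S0: "compact S0" unfolding S0_def by (intro compact_Int_closed) auto
  have S0S: "S0 \<subseteq> S" using d by (auto simp: S0_def)
  have x1: "x1 \<in> S0" using d R by (simp add: S0_def t_def)
  have "continuous_on S0 (\<lambda>x. V x - Q x)"
    unfolding V_def Q_def using d
    by (intro continuous_intros tc continuous_on_subset[OF uc S0S] continuous_on_subset[OF Gc S0S]) auto
  then obtain \<xi> where \<xi>: "\<xi> \<in> S0" and min: "\<And>x. x \<in> S0 \<Longrightarrow> V \<xi> - Q \<xi> \<le> V x - Q x"
    using continuous_attains_inf[OF S0, of "\<lambda>x. V x - Q x"] x1 by blast
  have "Q x1 = m * d / 4" using d by (simp add: Q_def t_def power2_eq_square field_simps)
  then have neg: "V \<xi> < Q \<xi>" using min[OF x1] V1 m d mult_pos_pos[of m d] by linarith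
  have \<xi>S: "\<xi> \<in> S" using \<xi> S0S by auto
  have tl: "\<bar>t \<xi>\<bar> \<le> 2 * d" and nl: "norm (\<xi> - x1) \<le> R * d"
    using \<xi> by (auto simp: S0_def dist_norm norm_minus_commute)
  have sq: "m / (16 * d) * (4 * d)\<^sup>2 = m * d" using d by (simp add: power2_eq_square field_simps)
  have Qle: "Q \<xi> \<le> m * d"
  proof -
    have "(t \<xi> + 2 * d)\<^sup>2 \<le> (4 * d)\<^sup>2" using tl by (intro power_mono) auto
    then have "m / (16 * d) * (t \<xi> + 2 * d)\<^sup>2 \<le> m * d"
      unfolding sq[symmetric] using m d by (intro mult_left_mono) auto
    moreover have "0 \<le> m / (R\<^sup>2 * d) * (norm (\<xi> - x1))\<^sup>2" using m d by simp
    ultimately show ?thesis by (simp add: Q_def)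
  qed
  have i1: "norm (\<xi> - x1) < R * d"
  proof (rule ccontr)
    assume "\<not> norm (\<xi> - x1) < R * d"
    then have eq: "norm (\<xi> - x1) = R * d" using nl by simp
    have "m / (R\<^sup>2 * d) * (norm (\<xi> - x1))\<^sup>2 = m * d"
      unfolding eq using d R by (simp add: power2_eq_square field_simps)
    moreover have "(t \<xi> + 2 * d)\<^sup>2 \<le> (4 * d)\<^sup>2" using tl by (intro power_mono) auto
    then have "m / (16 * d) * (t \<xi> + 2 * d)\<^sup>2 \<le> m * d"
      unfolding sq[symmetric] using m d by (intro mult_left_mono) auto
    ultimately have "Q \<xi> \<le> 0" by (simp add: Q_def)
    then show False using neg V0[OF \<xi>S] by simp
  qed
  have i2: "t \<xi> < 2 * d"
  proof (rule ccontr)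
    assume "\<not> t \<xi> < 2 * d"
    then have "t \<xi> = 2 * d" using tl by simp
    then have "m * d \<le> V \<xi>" using Vm[OF \<xi>S] by (simp add: t_def)
    then show False using neg Qle by simp
  qed
  have i3: "- (2 * d) < t \<xi>"
  proof (rule ccontr)
    assume "\<not> - (2 * d) < t \<xi>"
    then have "t \<xi> = - (2 * d)" using tl by simp
    then have "Q \<xi> \<le> 0" using m d by (simp add: Q_def)
    then show False using neg V0[OF \<xi>S] by simp
  qed
  define S1 where "S1 = ball x1 (R * d) \<inter> {x. t x < 2 * d} \<inter> {x. - (2 * d) < t x}"
  have S1: "open S1" unfolding S1_def
    by (intro open_Int open_Collect_less continuous_intros tc) auto
  have S1S0: "S1 \<subseteq> S0" by (auto simp: S1_def S0_def)
  have \<xi>1: "\<xi> \<in> S1" using i1 i2 i3 by (simp add: S1_def dist_norm norm_minus_commute)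
  define p where "p = g \<xi> - \<kappa> *\<^sub>R (\<xi> - y1) + ((m / (8 * d)) * (t \<xi> + 2 * d)) *\<^sub>R e - (2 * m / (R\<^sup>2 * d)) *\<^sub>R (\<xi> - x1)"
  define \<alpha> where "\<alpha> = - c - \<kappa> - 2 * m / (R\<^sup>2 * d)"
  have visc: "lam * (m / (8 * d)) + 3 * Lam * real CARD('n) * \<alpha> \<le> norm p + norm_pow p \<gamma> * f \<xi>"
  proof (rule viscosity_quadratic_test[OF vis lam e(1) _ _ S1 \<xi>1])
    have "0 \<le> 2 * m / (R\<^sup>2 * d)" using m d by (intro divide_nonneg_nonneg mult_nonneg_nonneg) auto
    then show "\<alpha> \<le> 0" using c \<kappa> by (simp add: \<alpha>_def)
    show "0 \<le> m / (8 * d)" using m d by simp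
    show "S1 \<subseteq> ball 0 1" using S1S0 S0S S by auto
    fix x assume x: "x \<in> S1"
    then have xS': "x \<in> S0" "x \<in> S" using S1S0 S0S by auto
    define h where "h = x - \<xi>"
    have tx: "t x = t \<xi> + e \<bullet> h" by (simp add: t_def h_def inner_simps)
    have n1: "(norm (x - y1))\<^sup>2 = (norm (\<xi> - y1))\<^sup>2 + 2 * ((\<xi> - y1) \<bullet> h) + (norm h)\<^sup>2"
      and n2: "(norm (x - x1))\<^sup>2 = (norm (\<xi> - x1))\<^sup>2 + 2 * ((\<xi> - x1) \<bullet> h) + (norm h)\<^sup>2"
      by (simp_all add: h_def power2_norm_eq_inner inner_simps inner_commute)
    have "u \<xi> + (G x - G \<xi>) - \<kappa> / 2 * ((norm (x - y1))\<^sup>2 - (norm (\<xi> - y1))\<^sup>2) + (Q x - Q \<xi>) \<le> u x"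
      using min[OF xS'(1)] unfolding V_def by (simp add: algebra_simps)
    moreover have "g \<xi> \<bullet> h - c / 2 * (norm h)\<^sup>2 \<le> G x - G \<xi>"
      using semi[OF xS'(2) \<xi>S] by (simp add: h_def)
    ultimately have "u \<xi> + (g \<xi> \<bullet> h - c / 2 * (norm h)\<^sup>2) - \<kappa> / 2 * (2 * ((\<xi> - y1) \<bullet> h) + (norm h)\<^sup>2)
       + (m / (16 * d) * (2 * (t \<xi> + 2 * d) * (e \<bullet> h) + (e \<bullet> h)\<^sup>2) - m / (R\<^sup>2 * d) * (2 * ((\<xi> - x1) \<bullet> h) + (norm h)\<^sup>2)) \<le> u x"
      unfolding Q_def n1 n2 tx by (simp add: algebra_simps power2_eq_square)
    moreover have "u \<xi> + (g \<xi> \<bullet> h - c / 2 * (norm h)\<^sup>2) - \<kappa> / 2 * (2 * ((\<xi> - y1) \<bullet> h) + (norm h)\<^sup>2)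
       + (B * (2 * (t \<xi> + 2 * d) * (e \<bullet> h) + (e \<bullet> h)\<^sup>2) - A * (2 * ((\<xi> - x1) \<bullet> h) + (norm h)\<^sup>2))
       = u \<xi> + (g \<xi> - \<kappa> *\<^sub>R (\<xi> - y1) + ((2 * B) * (t \<xi> + 2 * d)) *\<^sub>R e - (2 * A) *\<^sub>R (\<xi> - x1)) \<bullet> h
         + (- c - \<kappa> - 2 * A) / 2 * (norm h)\<^sup>2 + (2 * B) / 2 * (e \<bullet> h)\<^sup>2" for A B
      by (simp add: inner_simps algebra_simps) (simp add: field_simps)
    moreover have "m / (8 * d) = 2 * (m / (16 * d))" "2 * m / (R\<^sup>2 * d) = 2 * (m / (R\<^sup>2 * d))"
      by simp_all
    ultimately have "u \<xi> + p \<bullet> h + \<alpha> / 2 * (norm h)\<^sup>2 + m / (8 * d) / 2 * (e \<bullet> h)\<^sup>2 \<le> u x"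
      unfolding p_def \<alpha>_def by metis
    then show "u \<xi> + p \<bullet> (x - \<xi>) + \<alpha> / 2 * (norm (x - \<xi>))\<^sup>2 + m / (8 * d) / 2 * (e \<bullet> (x - \<xi>))\<^sup>2 \<le> u x"
      by (simp add: h_def)
  qed
  have "norm p \<le> norm (g \<xi>) + norm (\<kappa> *\<^sub>R (\<xi> - y1)) + norm (((m / (8 * d)) * (t \<xi> + 2 * d)) *\<^sub>R e) + norm ((2 * m / (R\<^sup>2 * d)) *\<^sub>R (\<xi> - x1))"
    unfolding p_def by (intro order_trans[OF norm_triangle_ineq4] add_mono order_trans[OF norm_triangle_ineq] order.refl)
  also have "\<dots> \<le> c + \<kappa> * 2 + m / 2 + m / 2"
  proof (intro add_mono)
    show "norm (g \<xi>) \<le> c" by (rule slope[OF \<xi>S])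
    show "norm (\<kappa> *\<^sub>R (\<xi> - y1)) \<le> \<kappa> * 2" using far(1)[OF \<xi>S] \<kappa> by simp
    have "m / (8 * d) * \<bar>t \<xi> + 2 * d\<bar> \<le> m / (8 * d) * (4 * d)"
      using tl m d by (intro mult_left_mono) auto
    also have "\<dots> = m / 2" using d by simp
    finally show "norm (((m / (8 * d)) * (t \<xi> + 2 * d)) *\<^sub>R e) \<le> m / 2"
      using m d e by (simp add: abs_mult)
    have "2 * m / (R\<^sup>2 * d) * norm (\<xi> - x1) \<le> 2 * m / (R\<^sup>2 * d) * (R * d)"
      using nl m d by (intro mult_left_mono) auto
    also have "\<dots> = 2 * m / R" using d R by (simp add: power2_eq_square)
    also have "\<dots> \<le> m / 2" using R m by (simp add: field_simps)
    finally show "norm ((2 * m / (R\<^sup>2 * d)) *\<^sub>R (\<xi> - x1)) \<le> m / 2"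
      using m d R by (simp add: abs_mult)
  qed
  also have "\<dots> \<le> c + 4 * \<kappa>" using mult_left_mono[OF far(2), of \<kappa>] \<kappa> mn by simp
  finally have p: "norm p \<le> c + 4 * \<kappa>" .
  \<comment> \<open>\<open>R\<close> is so large that the concave part of \<open>Q\<close> costs at most half of the convex part.\<close>
  have absorb: "3 * Lam * N * (2 * m / (R\<^sup>2 * d)) \<le> lam * m / (16 * d)"
  proof -
    have "96 * Lam * N \<le> lam * R\<^sup>2" using R(2) rat lam by (simp add: field_simps)
    then have "3 * Lam * N * 2 / R\<^sup>2 \<le> lam / 16" using R by (simp add: field_simps)
    then have "3 * Lam * N * 2 / R\<^sup>2 * (m / d) \<le> lam / 16 * (m / d)" using m d by (intro mult_right_mono) auto
    then show ?thesis by (simp add: field_simps)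
  qed
  have np: "0 \<le> norm_pow p \<gamma>" by (simp add: norm_pow_def)
  have "norm_pow p \<gamma> * f \<xi> \<le> norm_pow p \<gamma> * \<bar>f \<xi>\<bar>"
    using np by (intro mult_left_mono) auto
  then have "lam * (m / (8 * d)) - 3 * Lam * N * (c + \<kappa>) - 3 * Lam * N * (2 * m / (R\<^sup>2 * d)) \<le> norm p + norm_pow p \<gamma> * \<bar>f \<xi>\<bar>"
    using visc unfolding \<alpha>_def N_def by (simp add: algebra_simps)
  moreover have "lam * (m / (8 * d)) = lam * m / (16 * d) + lam * m / (16 * d)" by (simp add: field_simps)
  ultimately have "lam * m / (16 * d) \<le> 3 * Lam * N * (c + \<kappa>) + norm p + norm_pow p \<gamma> * \<bar>f \<xi>\<bar>"
    using absorb by linarith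
  then have "norm (y1 - y2) \<le> d * (16 / (lam * \<kappa>) * (3 * Lam * N * (c + \<kappa>) + norm p + norm_pow p \<gamma> * \<bar>f \<xi>\<bar>))"
    unfolding mn using lam \<kappa> d by (simp add: field_simps)
  then show ?thesis using that[of \<xi> p] i1 p by (simp add: dist_norm norm_minus_commute)
qed

section \<open>The area estimate\<close>

text \<open>If \<open>L w\<close> is a local Lipschitz bound for the relation \<open>T\<close> on \<open>A\<close>, then passing from \<open>A\<close> to its
  image \<open>Y\<close> multiplies volumes by at most \<open>(L w)\<^sup>n\<close>, up to a dimensional constant. Cover \<open>A\<close> by
  nonoverlapping dyadic cubes, each so small that around it \<open>w\<close> at most doubles and \<open>h\<close> at most halves. The
  image of a cube of side \<open>s\<close> then lies in a cube of side comparable to \<open>L w s\<close>. The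
  factor \<open>2\<close> pays for the variation of \<open>h\<close>, and the factor \<open>(4 n L)\<^sup>n\<close> for that of \<open>w\<close> and for the
  diameter of a cube.\<close>

lemma emeasure_locally_Lipschitz_cover:
  fixes Y A S O' :: "(real^'n) set" and T :: "real^'n \<Rightarrow> real^'n \<Rightarrow> bool" and w h :: "real^'n \<Rightarrow> real"
  defines "N \<equiv> real CARD('n)"
  assumes lip: "\<And>x1 x2 y1 y2 d. x1 \<in> A \<Longrightarrow> x2 \<in> A \<Longrightarrow> T x1 y1 \<Longrightarrow> T x2 y2 \<Longrightarrow> 0 < d \<Longrightarrow> norm (x1 - x2) \<le> d \<Longrightarrow>
      cball x1 (R * d) \<subseteq> S \<Longrightarrow> \<exists>\<xi> \<in> cball x1 (R * d). norm (y1 - y2) \<le> d * (L * w \<xi>)"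
    and L: "0 \<le> L" and R: "0 \<le> R" and ex: "\<And>y. y \<in> Y \<Longrightarrow> \<exists>x\<in>A. T x y" "\<And>x. x \<in> A \<Longrightarrow> \<exists>y. T x y"
    and O: "open O'" "O' \<subseteq> S" "A \<subseteq> O'" "bounded A"
    and w: "continuous_on S w" "\<And>x. x \<in> A \<Longrightarrow> 0 < w x"
    and h: "continuous_on S h" "\<And>x. x \<in> A \<Longrightarrow> w x ^ CARD('n) \<le> h x"
  shows "emeasure lebesgue Y \<le> ennreal (2 * (4 * N * L) ^ CARD('n)) * (\<integral>\<^sup>+x\<in>O'. ennreal (h x) \<partial>lebesgue)"
proof -
  let ?n = "CARD('n)"
  define C where "C = 2 * (4 * N * L) ^ ?n"
  have cm: "measure lebesgue (cbox a b) = measure lborel (cbox a b)" for a b :: "real^'n"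
    by (rule measure_completion) simp
  have N1: "1 \<le> N" unfolding N_def by (rule one_le_card)
  have "\<exists>r>0. ball x r \<subseteq> O' \<and> (\<forall>z\<in>ball x r. w z \<le> 2 * w x \<and> h x \<le> 2 * h z)" if "x \<in> A" for x
  proof -
    have xO: "x \<in> O'" using that O by auto
    have hx: "0 < h x" using h(2)[OF that] w(2)[OF that] zero_less_power[of "w x" ?n] by linarith
    have wc: "continuous_on O' w" and hc: "continuous_on O' h" using w h O(2) continuous_on_subset by blast+
    have "open (O' \<inter> w -` {..<2 * w x})" "open (O' \<inter> h -` {h x / 2<..})"
      using wc hc O(1) by (auto intro: continuous_open_preimage)
    then have "open (O' \<inter> w -` {..<2 * w x} \<inter> (O' \<inter> h -` {h x / 2<..}))" by blast
    moreover have "x \<in> O' \<inter> w -` {..<2 * w x} \<inter> (O' \<inter> h -` {h x / 2<..})"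
      using xO w(2)[OF that] hx by auto
    ultimately obtain r where "r > 0" "ball x r \<subseteq> O' \<inter> w -` {..<2 * w x} \<inter> (O' \<inter> h -` {h x / 2<..})"
      using openE by blast
    then show ?thesis by (intro exI[of _ r]) (force dest: subsetD)
  qed
  then obtain \<rho> where \<rho>: "\<And>x. x \<in> A \<Longrightarrow> \<rho> x > 0" "\<And>x. x \<in> A \<Longrightarrow> ball x (\<rho> x) \<subseteq> O'"
    "\<And>x z. x \<in> A \<Longrightarrow> z \<in> ball x (\<rho> x) \<Longrightarrow> w z \<le> 2 * w x" "\<And>x z. x \<in> A \<Longrightarrow> z \<in> ball x (\<rho> x) \<Longrightarrow> h x \<le> 2 * h z"
    by metis
  \<comment> \<open>If a cube of side \<open>s\<close> lies in the ball of radius \<open>\<sigma> x\<close>, then \<open>s \<le> 2 \<sigma> x\<close>, its diameter is at most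
    \<open>N s\<close>, and hence the ball of radius \<open>R N s\<close> in which \<open>w\<close> is evaluated stays within \<open>\<rho> x\<close>.\<close>
  define \<sigma> where "\<sigma> x = (if x \<in> A then \<rho> x / (2 * R * N + 1) else 1)" for x
  have RN: "0 < 2 * R * N + 1" using R N1 by (simp add: add_nonneg_pos)
  have \<sigma>: "0 < \<sigma> x" for x using \<rho>(1) RN by (simp add: \<sigma>_def)
  have gauge: "gauge (\<lambda>x. ball x (\<sigma> x))" using \<sigma> by (simp add: gauge_def)
  obtain b where b: "0 < b" "\<And>x. x \<in> A \<Longrightarrow> norm x \<le> b" using O(4) bounded_pos by blast
  have Asub: "A \<subseteq> cbox (\<chi> i. - b) (\<chi> i. b)"
  proof
    fix x assume "x \<in> A"
    then have "\<bar>x $ i\<bar> \<le> b" for i using b(2) component_le_norm_cart[of x i] by (meson order_trans)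
    then show "x \<in> cbox (\<chi> i. - b) (\<chi> i. b)" by (auto simp: mem_box_cart abs_le_iff minus_le_iff)
  qed
  have bne: "box (\<chi> i. - b) (\<chi> i. b) \<noteq> ({} :: (real^'n) set)"
    using b by (auto simp: interval_ne_empty_cart)
  obtain \<D> where \<D>: "countable \<D>"
      "\<And>K. K \<in> \<D> \<Longrightarrow> interior K \<noteq> {} \<and> (\<exists>c d. K = cbox c d)"
      "pairwise (\<lambda>A B. interior A \<inter> interior B = {}) \<D>"
      "\<And>K. K \<in> \<D> \<Longrightarrow> \<exists>x \<in> A \<inter> K. K \<subseteq> ball x (\<sigma> x)"
      "\<And>u v. cbox u v \<in> \<D> \<Longrightarrow> \<exists>n. \<forall>i \<in> Basis. v \<bullet> i - u \<bullet> i = ((\<chi> i. b) \<bullet> i - (\<chi> i. - b) \<bullet> i) / 2^n"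
      "A \<subseteq> \<Union>\<D>"
    using covering_lemma[OF Asub bne gauge] by metis
  define H where "H x = indicator O' x *\<^sub>R h x" for x
  have "H \<in> borel_measurable borel" unfolding H_def
    using O h(1) by (intro borel_measurable_continuous_on_indicator) (auto intro: continuous_on_subset)
  then have Hm: "(\<lambda>x. ennreal (H x)) \<in> borel_measurable lebesgue"
    by (auto intro!: measurable_completion)
  define \<mu> where "\<mu> = density lebesgue (\<lambda>x. ennreal (H x))"
  have s\<mu>: "sets \<mu> = sets lebesgue" by (simp add: \<mu>_def)
  have "\<exists>Z \<in> sets lebesgue. {y \<in> Y. \<exists>x \<in> K \<inter> A. T x y} \<subseteq> Z \<and> emeasure lebesgue Z \<le> ennreal C * emeasure \<mu> (interior K)"
    if K: "K \<in> \<D>" for K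
  proof -
    obtain u v where uv: "K = cbox u v" using \<D>(2)[OF K] by blast
    have uvne: "box u v \<noteq> {}" using \<D>(2)[OF K] uv by (simp add: interior_cbox)
    obtain k where "\<forall>i \<in> Basis. v \<bullet> i - u \<bullet> i = ((\<chi> i. b) \<bullet> i - (\<chi> i. - b) \<bullet> i) / 2^k"
      using \<D>(5) K uv by blast
    then have side: "v $ i - u $ i = 2 * b / 2 ^ k" for i
      by (metis axis_in_Basis_iff cart_eq_inner_axis Basis_real_def insertI1 add_uminus_conv_diff diff_minus_eq_add mult_2 vec_lambda_beta)
    define s where "s = 2 * b / 2 ^ k"
    have s: "0 < s" using b by (simp add: s_def)
    obtain x where x: "x \<in> A" "x \<in> K" "K \<subseteq> ball x (\<sigma> x)" using \<D>(4)[OF K] by blast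
    have uvK: "u \<in> K" "v \<in> K" using uvne uv box_subset_cbox by (auto simp: box_ne_empty mem_box less_imp_le)
    have "s \<le> 2 * \<sigma> x"
    proof -
      fix i :: 'n
      have "s = \<bar>(v - u) $ i\<bar>" using side[of i] b by (simp add: s_def)
      also have "\<dots> \<le> norm (v - u)" by (rule component_le_norm_cart)
      also have "\<dots> \<le> dist x v + dist x u" by (metis dist_norm dist_commute dist_triangle2)
      also have "\<dots> \<le> \<sigma> x + \<sigma> x" using x(3) uvK by (intro add_mono) (auto intro: less_imp_le)
      finally show ?thesis by simp
    qed
    then have "R * (N * s) \<le> R * N * (2 * \<sigma> x)" using R N1 by (simp add: mult.assoc mult_left_mono)
    also have "\<dots> < \<rho> x"
    proof -
      have "R * N * (2 * \<sigma> x) = \<rho> x * (2 * R * N / (2 * R * N + 1))" using x by (simp add: \<sigma>_def)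
      also have "\<dots> < \<rho> x * 1"
        using \<rho>(1)[OF x(1)] RN by (intro mult_strict_left_mono) (auto simp: divide_less_eq)
      finally show ?thesis by simp
    qed
    finally have Rd: "R * (N * s) < \<rho> x" .
    have "\<sigma> x \<le> \<rho> x" using x(1) \<rho>(1)[OF x(1)] RN R N1 by (simp add: \<sigma>_def divide_le_eq)
    then have K\<rho>: "K \<subseteq> ball x (\<rho> x)" using x(3) by force
    obtain y where y: "T x y" using ex(2) x by blast
    define l where "l = N * s * (L * (2 * w x))"
    have wx: "0 < w x" using w(2) x by blast
    define Z where "Z = cbox (\<chi> i. y $ i - l) (\<chi> i. y $ i + l)"
    have "y' \<in> Z" if ty: "y' \<in> Y" "x' \<in> K \<inter> A" "T x' y'" for x' y'
    proof -
      have "norm (x - x') \<le> (\<Sum>i\<in>UNIV. \<bar>(x - x') $ i\<bar>)" by (rule norm_le_l1_cart)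
      also have "\<dots> \<le> (\<Sum>i\<in>(UNIV :: 'n set). s)"
      proof (rule sum_mono)
        fix i
        have "u $ i \<le> x $ i" "x $ i \<le> v $ i" "u $ i \<le> x' $ i" "x' $ i \<le> v $ i"
          using x that uv by (auto simp: mem_box_cart)
        then show "\<bar>(x - x') $ i\<bar> \<le> s" using side[of i] by (simp add: s_def abs_if)
      qed
      also have "\<dots> = N * s" by (simp add: N_def)
      finally have "norm (x - x') \<le> N * s" .
      moreover have sub: "cball x (R * (N * s)) \<subseteq> ball x (\<rho> x)" using Rd by auto
      moreover have "ball x (\<rho> x) \<subseteq> S" using \<rho>(2)[OF x(1)] O by auto
      moreover have "0 < N * s" using s N1 by simp
      ultimately obtain \<xi> where \<xi>: "\<xi> \<in> cball x (R * (N * s))" "norm (y - y') \<le> N * s * (L * w \<xi>)"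
        using lip[of x x' y y' "N * s"] x(1) ty(2,3) y by (meson IntD2 order_trans)
      then have "w \<xi> \<le> 2 * w x" using \<rho>(3) x sub by blast
      then have "N * s * (L * w \<xi>) \<le> l" unfolding l_def using s N1 L by (intro mult_left_mono) auto
      then have "norm (y - y') \<le> l" using \<xi> by simp
      then have yl: "\<bar>(y - y') $ i\<bar> \<le> l" for i using component_le_norm_cart order_trans by blast
      have "y $ i - l \<le> y' $ i \<and> y' $ i \<le> y $ i + l" for i
        using yl[of i] by (simp add: abs_le_iff algebra_simps)
      then show ?thesis by (simp add: Z_def mem_box_cart)
    qed
    moreover have "Z \<in> sets lebesgue" by (simp add: Z_def)
    moreover have "emeasure lebesgue Z \<le> ennreal C * emeasure \<mu> (interior K)"
    proof -
      have l: "0 \<le> l" using s N1 wx L by (simp add: l_def)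
      have "measure lebesgue Z = (\<Prod>i\<in>(UNIV :: 'n set). 2 * l)"
        unfolding Z_def cm using l by (subst content_cbox_cart) (auto simp: interval_ne_empty_cart)
      also have "\<dots> = (2 * l) ^ ?n" by simp
      also have "\<dots> = (4 * N * L) ^ ?n * (w x ^ ?n * s ^ ?n)"
      proof -
        have "2 * l = 4 * N * L * (w x * s)" by (simp add: l_def)
        then show ?thesis by (simp only: power_mult_distrib)
      qed
      also have "\<dots> \<le> (4 * N * L) ^ ?n * (h x * s ^ ?n)"
        using N1 L s h(2)[OF x(1)] by (intro mult_left_mono mult_right_mono) auto
      also have "s ^ ?n = measure lebesgue K"
      proof -
        have "measure lebesgue K = (\<Prod>i\<in>(UNIV :: 'n set). s)"
          unfolding uv cm using uvK uv by (subst content_cbox_cart) (auto simp: side s_def)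
        then show ?thesis by simp
      qed
      finally have "measure lebesgue Z \<le> C * (h x / 2 * measure lebesgue K)" by (simp add: C_def)
      then have "emeasure lebesgue Z \<le> ennreal (C * (h x / 2 * measure lebesgue K))"
        unfolding Z_def by (simp add: emeasure_eq_measure2 ennreal_leI)
      also have "\<dots> = ennreal C * (ennreal (h x / 2) * emeasure lebesgue (interior K))"
      proof -
        have "0 \<le> h x" using h(2)[OF x(1)] zero_le_power[of "w x" ?n] wx by linarith
        moreover have "emeasure lebesgue (interior K) = ennreal (measure lebesgue K)"
          unfolding uv interior_cbox using uvne by (simp add: emeasure_lborel_box_eq emeasure_lborel_cbox_eq content_cbox_if measure_def)
        moreover have "0 \<le> C" using N1 L by (simp add: C_def)
        ultimately show ?thesis by (simp add: ennreal_mult[symmetric] ennreal_mult'')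
      qed
      also have "ennreal (h x / 2) * emeasure lebesgue (interior K) = (\<integral>\<^sup>+z. ennreal (h x / 2) * indicator (interior K) z \<partial>lebesgue)"
        by (rule nn_integral_cmult_indicator[symmetric]) simp
      also have "\<dots> \<le> (\<integral>\<^sup>+z. ennreal (H z) * indicator (interior K) z \<partial>lebesgue)"
      proof (rule nn_integral_mono)
        fix z
        show "ennreal (h x / 2) * indicator (interior K) z \<le> ennreal (H z) * indicator (interior K) z"
        proof (cases "z \<in> interior K")
          case True
          then have "z \<in> ball x (\<rho> x)" using K\<rho> interior_subset by blast
          then have "z \<in> O'" "h x \<le> 2 * h z" using \<rho>(2,4)[OF x(1)] by blast+
          then have "h x / 2 \<le> H z" by (simp add: H_def)
          then show ?thesis by (simp add: ennreal_leI mult_right_mono)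
        qed simp
      qed
      also have "\<dots> = emeasure \<mu> (interior K)" unfolding \<mu>_def by (subst emeasure_density[OF Hm]) auto
      finally show ?thesis by (simp add: mult_left_mono)
    qed
    ultimately show ?thesis by blast
  qed
  then have "\<forall>K\<in>\<D>. \<exists>Z. Z \<in> sets lebesgue \<and> {y \<in> Y. \<exists>x \<in> K \<inter> A. T x y} \<subseteq> Z \<and>
      emeasure lebesgue Z \<le> ennreal C * emeasure \<mu> (interior K)" by (simp only: Bex_def) simp
  from bchoice[OF this] obtain Z where "\<forall>K\<in>\<D>. Z K \<in> sets lebesgue \<and>
      {y \<in> Y. \<exists>x \<in> K \<inter> A. T x y} \<subseteq> Z K \<and> emeasure lebesgue (Z K) \<le> ennreal C * emeasure \<mu> (interior K)" ..
  note Z = this[THEN bspec, THEN conjunct1] this[THEN bspec, THEN conjunct2, THEN conjunct1]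
    this[THEN bspec, THEN conjunct2, THEN conjunct2]
  define I where "I = to_nat_on \<D> ` \<D>"
  define Z' where "Z' i = (if i \<in> I then Z (from_nat_into \<D> i) else {})" for i
  define B' where "B' i = (if i \<in> I then interior (from_nat_into \<D> i) else {})" for i
  have fI: "from_nat_into \<D> i \<in> \<D>" if "i \<in> I" for i using that \<D>(1) by (auto simp: I_def)
  have "Y \<subseteq> (\<Union>i. Z' i)"
  proof
    fix y assume yY: "y \<in> Y"
    then obtain x K where "x \<in> A" "T x y" "x \<in> K" "K \<in> \<D>" using ex(1) \<D>(6) by blast
    then have "y \<in> Z K" using Z(2) yY by blast
    then have "y \<in> Z' (to_nat_on \<D> K)" using \<open>K \<in> \<D>\<close> \<D>(1) by (simp add: Z'_def I_def)
    then show "y \<in> (\<Union>i. Z' i)" by blast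
  qed
  moreover have Zm: "range Z' \<subseteq> sets lebesgue" using Z(1) fI by (auto simp: Z'_def)
  ultimately have "emeasure lebesgue Y \<le> emeasure lebesgue (\<Union>i. Z' i)" by (intro emeasure_mono) auto
  also have "\<dots> \<le> (\<Sum>i. emeasure lebesgue (Z' i))" by (rule emeasure_subadditive_countably[OF Zm])
  also have "\<dots> \<le> (\<Sum>i. ennreal C * emeasure \<mu> (B' i))"
    by (intro suminf_le) (use Z(3) fI in \<open>auto simp: Z'_def B'_def\<close>)
  also have "\<dots> = ennreal C * (\<Sum>i. emeasure \<mu> (B' i))" by simp
  also have "(\<Sum>i. emeasure \<mu> (B' i)) = emeasure \<mu> (\<Union>i. B' i)"
  proof (rule suminf_emeasure)
    show "range B' \<subseteq> sets \<mu>" by (auto simp: B'_def s\<mu>)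
    show "disjoint_family B'"
      unfolding disjoint_family_on_def
    proof (intro ballI impI)
      fix i j :: nat assume "i \<noteq> j"
      show "B' i \<inter> B' j = {}"
      proof (cases "i \<in> I \<and> j \<in> I")
        case True
        then have "from_nat_into \<D> i \<noteq> from_nat_into \<D> j"
          using \<open>i \<noteq> j\<close> \<D>(1) by (auto simp: I_def)
        then show ?thesis using True fI \<D>(3) unfolding pairwise_def B'_def by simp
      qed (auto simp: B'_def)
    qed
  qed
  also have "ennreal C * emeasure \<mu> (\<Union>i. B' i) \<le> ennreal C * emeasure \<mu> UNIV"
    by (intro mult_left_mono emeasure_mono) (auto simp: \<mu>_def)
  also have "emeasure \<mu> UNIV = (\<integral>\<^sup>+x. ennreal (H x) \<partial>lebesgue)"
    unfolding \<mu>_def by (subst emeasure_density[OF Hm]) auto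
  also have "\<dots> = (\<integral>\<^sup>+x\<in>O'. ennreal (h x) \<partial>lebesgue)"
    by (intro nn_integral_cong) (auto simp: H_def indicator_def)
  finally show ?thesis unfolding C_def .
qed

lemma norm_pow_le:
  assumes "norm p \<le> C * \<kappa>" "1 \<le> C" "0 < \<kappa>" "0 \<le> \<gamma>" "\<gamma> < 1"
  shows "norm_pow p \<gamma> \<le> C * \<kappa> powr \<gamma>"
proof (cases "\<gamma> = 0")
  case True then show ?thesis using assms by (simp add: norm_pow_def)
next
  case False
  have "norm p powr \<gamma> \<le> (C * \<kappa>) powr \<gamma>" using assms by (intro powr_mono2) auto
  also have "\<dots> = C powr \<gamma> * \<kappa> powr \<gamma>" using assms by (simp add: powr_mult)
  also have "\<dots> \<le> C powr 1 * \<kappa> powr \<gamma>" using assms by (intro mult_right_mono powr_mono) auto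
  finally show ?thesis using False assms by (simp add: norm_pow_def)
qed

text \<open>The Alexandrov-Bakelman-Pucci type estimate: if every vertex \<open>y \<in> Y\<close> produces a contact
  point in \<open>A\<close>, then \<open>|Y|\<close> is bounded by the integral of \<open>(1 + \<kappa>\<^sup>\<gamma>\<^sup>-\<^sup>1 |f|)\<^sup>n\<close> over \<open>A\<close>. This weight
  arises because at contact points the gradient of the test function has size at most a multiple of \<open>\<kappa>\<close>,
  so that \<open>|D\<phi>|\<^sup>\<gamma> f / \<kappa>\<close> is controlled by \<open>\<kappa>\<^sup>\<gamma>\<^sup>-\<^sup>1 |f|\<close>. The weight is dominated on \<open>A\<close> by a
  continuous function \<open>h\<close>, and the integral is taken over an open \<open>U \<supseteq> A\<close>; both can be chosen to
  fit the use.\<close>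

lemma emeasure_vertices_le:
  fixes lam Lam \<kappa> c :: real and u G h :: "real^'n \<Rightarrow> real" and g :: "real^'n \<Rightarrow> real^'n"
    and A S U Y :: "(real^'n) set"
  defines "N \<equiv> real CARD('n)"
  defines "C \<equiv> 16 / lam * (3 * Lam * N * (c + 1) + c + 4)"
  assumes vis: "viscosity_supersol lam Lam \<gamma> f u" and lam: "0 < lam" "lam \<le> Lam"
    and \<gamma>: "0 \<le> \<gamma>" "\<gamma> < 1" and f: "continuous_on S f"
    and S: "open S" "S \<subseteq> ball 0 1" and uc: "continuous_on S u" and Gc: "continuous_on S G"
    and semi: "\<And>x \<xi>. x \<in> S \<Longrightarrow> \<xi> \<in> S \<Longrightarrow> G \<xi> + g \<xi> \<bullet> (x - \<xi>) - c * \<kappa> / 2 * (norm (x - \<xi>))\<^sup>2 \<le> G x"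
    and slope: "\<And>\<xi>. \<xi> \<in> S \<Longrightarrow> norm (g \<xi>) \<le> c * \<kappa>" and c: "0 \<le> c" and \<kappa>: "0 < \<kappa>"
    and Y: "Y \<subseteq> cball 0 1" and U: "open U" "A \<subseteq> U" "U \<subseteq> S"
    and touch: "\<And>y. y \<in> Y \<Longrightarrow> \<exists>x\<in>A. \<forall>z\<in>S.
       u x - G x + \<kappa> / 2 * (norm (x - y))\<^sup>2 \<le> u z - G z + \<kappa> / 2 * (norm (z - y))\<^sup>2"
    and h: "continuous_on S h"
    and hA: "\<And>x y. x \<in> A \<Longrightarrow> y \<in> Y \<Longrightarrow> 
        \<forall>z\<in>S. u x - G x + \<kappa> / 2 * (norm (x - y))\<^sup>2 \<le> u z - G z + \<kappa> / 2 * (norm (z - y))\<^sup>2 \<Longrightarrow>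
        (1 + \<kappa> powr (\<gamma> - 1) * \<bar>f x\<bar>) ^ CARD('n) \<le> h x"
  shows "emeasure lebesgue Y \<le> ennreal (2 * (4 * N * C) ^ CARD('n)) * (\<integral>\<^sup>+x\<in>U. ennreal (h x) \<partial>lebesgue)"
proof -
  define T where "T x y \<longleftrightarrow> y \<in> Y \<and>
    (\<forall>z\<in>S. u x - G x + \<kappa> / 2 * (norm (x - y))\<^sup>2 \<le> u z - G z + \<kappa> / 2 * (norm (z - y))\<^sup>2)" for x y
  define w where "w x = 1 + \<kappa> powr (\<gamma> - 1) * \<bar>f x\<bar>" for x
  define R where "R = 10 * (Lam * N / lam)"
  have N1: "1 \<le> N" unfolding N_def by (rule one_le_card)
  have C0: "0 \<le> C" using lam c N1 by (simp add: C_def)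
  have wpos: "0 < w x" for x by (simp add: w_def add_pos_nonneg)
  show ?thesis unfolding N_def
  proof (rule emeasure_locally_Lipschitz_cover[where A = "{x \<in> A. \<exists>y. T x y}" and T = T and R = R and S = S and w = w])
    fix x1 x2 y1 y2 d
    assume x: "x1 \<in> {x \<in> A. \<exists>y. T x y}" "x2 \<in> {x \<in> A. \<exists>y. T x y}" "T x1 y1" "T x2 y2"
      and d: "0 < d" "norm (x1 - x2) \<le> d" "cball x1 (R * d) \<subseteq> S"
    have c\<kappa>: "0 \<le> c * \<kappa>" using c \<kappa> by simp
    have xS: "x1 \<in> S" "x2 \<in> S" using x U by auto
    have t: "x \<in> S \<Longrightarrow> u x1 - G x1 + \<kappa> / 2 * (norm (x1 - y1))\<^sup>2 \<le> u x - G x + \<kappa> / 2 * (norm (x - y1))\<^sup>2"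
      "x \<in> S \<Longrightarrow> u x2 - G x2 + \<kappa> / 2 * (norm (x2 - y2))\<^sup>2 \<le> u x - G x + \<kappa> / 2 * (norm (x - y2))\<^sup>2" for x
      using x by (auto simp: T_def)
    have y: "norm y1 \<le> 1" "norm y2 \<le> 1" using x Y by (auto simp: T_def)
    have far: "norm (x - y1) \<le> 2" if "x \<in> S" for x
      using that S(2) y norm_triangle_ineq4[of x y1] by fastforce
    have far2: "norm (y1 - y2) \<le> 2" using y norm_triangle_ineq4[of y1 y2] by simp
    obtain \<xi> and p :: "real^'n" where \<xi>: "\<xi> \<in> cball x1 (R * d)" and p: "norm p \<le> c * \<kappa> + 4 * \<kappa>"
      and le: "norm (y1 - y2) \<le> d * (16 / (lam * \<kappa>) * (3 * Lam * N * (c * \<kappa> + \<kappa>) + norm p + norm_pow p \<gamma> * \<bar>f \<xi>\<bar>))"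
      by (rule touching_vertices_close[OF vis lam S uc Gc semi slope c\<kappa> \<kappa> t xS far far2 d(1,2)
          d(3)[unfolded R_def N_def], folded N_def, folded R_def])
    have "norm_pow p \<gamma> \<le> (c + 4) * \<kappa> powr \<gamma>"
      by (rule norm_pow_le) (use p c \<kappa> \<gamma> in \<open>auto simp: algebra_simps\<close>)
    also have "\<kappa> powr \<gamma> = \<kappa> * \<kappa> powr (\<gamma> - 1)" using \<kappa> by (simp add: powr_diff)
    finally have np: "norm_pow p \<gamma> * \<bar>f \<xi>\<bar> \<le> (c + 4) * (\<kappa> * \<kappa> powr (\<gamma> - 1)) * \<bar>f \<xi>\<bar>"
      by (intro mult_right_mono) auto
    define q where "q = \<kappa> powr (\<gamma> - 1) * \<bar>f \<xi>\<bar>"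
    have q: "0 \<le> q" by (simp add: q_def)
    have "3 * Lam * N * (c * \<kappa> + \<kappa>) + norm p + norm_pow p \<gamma> * \<bar>f \<xi>\<bar> \<le> \<kappa> * (3 * Lam * N * (c + 1) + (c + 4) + (c + 4) * q)"
      using np p by (simp add: q_def algebra_simps)
    also have "\<dots> \<le> \<kappa> * ((3 * Lam * N * (c + 1) + c + 4) * (1 + q))"
    proof (rule mult_left_mono)
      have "0 \<le> 3 * Lam * N * (c + 1) * q" using q lam N1 c by (intro mult_nonneg_nonneg) auto
      then show "3 * Lam * N * (c + 1) + (c + 4) + (c + 4) * q \<le> (3 * Lam * N * (c + 1) + c + 4) * (1 + q)"
        by (simp add: algebra_simps)
    qed (use \<kappa> in auto)
    finally have "16 / (lam * \<kappa>) * (3 * Lam * N * (c * \<kappa> + \<kappa>) + norm p + norm_pow p \<gamma> * \<bar>f \<xi>\<bar>)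
       \<le> 16 / (lam * \<kappa>) * (\<kappa> * ((3 * Lam * N * (c + 1) + c + 4) * (1 + q)))"
      using lam \<kappa> by (intro mult_left_mono) auto
    also have "\<dots> = C * w \<xi>" using \<kappa> by (simp add: C_def w_def q_def)
    finally have "norm (y1 - y2) \<le> d * (C * w \<xi>)"
      using le d(1) by (meson mult_left_mono less_imp_le order_trans)
    then show "\<exists>\<xi>\<in>cball x1 (R * d). norm (y1 - y2) \<le> d * (C * w \<xi>)" using \<xi> by blast
  next
    show "0 \<le> R" using lam N1 by (simp add: R_def)
    show "continuous_on S w" unfolding w_def by (intro continuous_intros f)
    show "\<exists>x\<in>{x \<in> A. \<exists>y. T x y}. T x y" if y: "y \<in> Y" for y
    proof -
      obtain x where "x \<in> A" "T x y" using touch[OF y] y unfolding T_def by (elim bexE) simp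
      then show ?thesis by blast
    qed
    show "bounded {x \<in> A. \<exists>y. T x y}"
    proof (rule bounded_subset[OF bounded_ball])
      show "{x \<in> A. \<exists>y. T x y} \<subseteq> ball 0 1" using U S(2) by auto
    qed
    show "w x ^ CARD('n) \<le> h x" if x: "x \<in> {x \<in> A. \<exists>y. T x y}" for x
    proof -
      obtain y where "x \<in> A" "T x y" using x by blast
      then show ?thesis unfolding w_def T_def by (elim conjE) (rule hA)
    qed
    show "{x \<in> A. \<exists>y. T x y} \<subseteq> U" using U(2) by blast
    show "\<exists>y. T x y" if "x \<in> {x \<in> A. \<exists>y. T x y}" for x using that by simp
    show "0 < w x" for x by (rule wpos)
    show "0 \<le> C" "open U" "U \<subseteq> S" "continuous_on S h" by (rule C0 U h)+
  qed
qed

section \<open>Contact sets and paraboloids\<close>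

text \<open>The infimum is attained at a contact point. Continuity of \<open>u\<close> allows testing against the closed
  ball, on which minimisers exist.\<close>

lemma mem_contact_set_iff:
  fixes u :: "real^'n \<Rightarrow> real"
  assumes u: "continuous_on (cball 0 1) u"
  shows "x \<in> contact_set \<kappa> u \<longleftrightarrow> x \<in> ball 0 1 \<and> (\<exists>y \<in> cball 0 1. \<forall>z \<in> cball 0 1.
     u x + \<kappa> / 2 * (norm (x - y))\<^sup>2 \<le> u z + \<kappa> / 2 * (norm (z - y))\<^sup>2)"
proof -
  have "(u x + \<kappa> / 2 * (norm (x - y))\<^sup>2 = (INF z \<in> ball 0 1. u z + \<kappa> / 2 * (norm (z - y))\<^sup>2)) \<longleftrightarrow>
     (\<forall>z \<in> cball 0 1. u x + \<kappa> / 2 * (norm (x - y))\<^sup>2 \<le> u z + \<kappa> / 2 * (norm (z - y))\<^sup>2)"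
    (is "?l = Inf (?F ` _) \<longleftrightarrow> ?R")
    if x: "x \<in> ball 0 1" for y
  proof
    have Fc: "continuous_on (cball 0 1) ?F" by (intro continuous_intros u)
    have "compact (?F ` cball 0 1)" by (intro compact_continuous_image Fc compact_cball)
    then have bd: "bdd_below (?F ` ball 0 1)"
      by (meson bounded_imp_bdd_below compact_imp_bounded bdd_below_mono image_mono ball_subset_cball)
    assume "?l = Inf (?F ` ball 0 1)"
    then have le: "?l \<le> ?F z" if "z \<in> ball 0 1" for z using cINF_lower[OF bd that] by simp
    show ?R
    proof
      fix z :: "real^'n" assume "z \<in> cball 0 1"
      then have z: "z \<in> closure (ball 0 1)" by simp
      show "?l \<le> ?F z"
        by (rule continuous_ge_on_closure[OF _ z le]) (use Fc in auto)
    qed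
  next
    assume R: ?R
    show "?l = Inf (?F ` ball 0 1)"
      by (rule cInf_eq_minimum[symmetric]) (use x R ball_subset_cball in auto)
  qed
  then show ?thesis by (auto simp: contact_set_def)
qed

text \<open>Vertices range over a compact set, so limits of contact points inside the ball are contact points.\<close>

lemma contact_set_borel:
  fixes u :: "real^'n \<Rightarrow> real"
  assumes u: "continuous_on (cball 0 1) u"
  shows "contact_set \<kappa> u \<in> sets borel"
proof -
  have "x \<in> contact_set \<kappa> u" if x: "x \<in> ball 0 1" "x \<in> closure (contact_set \<kappa> u)" for x
  proof -
    obtain X where X: "\<And>k. X k \<in> contact_set \<kappa> u" "X \<longlonglongrightarrow> x"
      using x(2) closure_sequential by blast
    then have "\<forall>k. \<exists>y. y \<in> cball 0 1 \<and> (\<forall>z \<in> cball 0 1.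
       u (X k) + \<kappa> / 2 * (norm (X k - y))\<^sup>2 \<le> u z + \<kappa> / 2 * (norm (z - y))\<^sup>2)"
      using mem_contact_set_iff[OF u] by blast
    then obtain Y where Y: "\<And>k. Y k \<in> cball 0 1" "\<And>k z. z \<in> cball 0 1 \<Longrightarrow>
       u (X k) + \<kappa> / 2 * (norm (X k - Y k))\<^sup>2 \<le> u z + \<kappa> / 2 * (norm (z - Y k))\<^sup>2"
      by metis
    obtain y \<sigma> where y: "y \<in> cball 0 1" "strict_mono (\<sigma> :: nat \<Rightarrow> nat)" "(Y \<circ> \<sigma>) \<longlonglongrightarrow> y"
      using compact_cball Y(1) unfolding compact_def by metis
    have Xs: "(X \<circ> \<sigma>) \<longlonglongrightarrow> x" using LIMSEQ_subseq_LIMSEQ[OF X(2) y(2)] .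
    have "(\<lambda>k. u ((X \<circ> \<sigma>) k)) \<longlonglongrightarrow> u x"
      by (rule continuous_on_tendsto_compose[OF u Xs])
         (use x X(1) in \<open>auto simp: contact_set_def intro!: always_eventually less_imp_le\<close>)
    then have lim: "(\<lambda>k. u ((X \<circ> \<sigma>) k) + \<kappa> / 2 * (norm ((X \<circ> \<sigma>) k - (Y \<circ> \<sigma>) k))\<^sup>2) \<longlonglongrightarrow> u x + \<kappa> / 2 * (norm (x - y))\<^sup>2"
      by (intro tendsto_intros Xs y(3))
    have "u x + \<kappa> / 2 * (norm (x - y))\<^sup>2 \<le> u z + \<kappa> / 2 * (norm (z - y))\<^sup>2" if "z \<in> cball 0 1" for z
    proof (rule LIMSEQ_le[OF lim])
      show "(\<lambda>k. u z + \<kappa> / 2 * (norm (z - (Y \<circ> \<sigma>) k))\<^sup>2) \<longlonglongrightarrow> u z + \<kappa> / 2 * (norm (z - y))\<^sup>2"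
        by (intro tendsto_intros y(3))
    qed (use Y(2)[OF that] in auto)
    then show ?thesis using x y mem_contact_set_iff[OF u] by blast
  qed
  then have "contact_set \<kappa> u = ball 0 1 \<inter> closure (contact_set \<kappa> u)"
    using closure_subset[of "contact_set \<kappa> u"] by (auto simp: contact_set_def)
  moreover have "ball 0 1 \<inter> closure (contact_set \<kappa> u) \<in> sets borel" by auto
  ultimately show ?thesis by metis
qed

lemma add_paraboloids:
  fixes y1 y2 :: "real^'n"
  assumes "0 \<le> a" "0 \<le> b" "0 < a + b" "y1 \<in> cball 0 1" "y2 \<in> cball 0 1"
  obtains y c where "y \<in> cball 0 1"
    "\<And>z. a / 2 * (norm (z - y1))\<^sup>2 + b / 2 * (norm (z - y2))\<^sup>2 = (a + b) / 2 * (norm (z - y))\<^sup>2 + c"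
proof -
  \<comment> \<open>The vertex of the sum is the weighted mean of the vertices, so it stays in the convex unit ball.\<close>
  define y where "y = (a / (a + b)) *\<^sub>R y1 + (b / (a + b)) *\<^sub>R y2"
  define c where "c = a / 2 * (y1 \<bullet> y1) + b / 2 * (y2 \<bullet> y2) - (a + b) / 2 * (y \<bullet> y)"
  have "y \<in> cball 0 1"
    unfolding y_def using assms
    by (intro convexD[OF convex_cball]) (auto simp: add_divide_distrib[symmetric])
  moreover have "a / 2 * (norm (z - y1))\<^sup>2 + b / 2 * (norm (z - y2))\<^sup>2 = (a + b) / 2 * (norm (z - y))\<^sup>2 + c" for z
  proof -
    have "(a + b) *\<^sub>R y = a *\<^sub>R y1 + b *\<^sub>R y2" using assms by (simp add: y_def scaleR_add_right)
    then have "(a + b) * (z \<bullet> y) = a * (z \<bullet> y1) + b * (z \<bullet> y2)"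
      by (metis inner_add_right inner_scaleR_right)
    moreover have "(norm (z - w))\<^sup>2 = z \<bullet> z - 2 * (z \<bullet> w) + w \<bullet> w" for w
      by (simp add: power2_norm_eq_inner inner_simps inner_commute)
    moreover have "a / 2 * (zz - 2 * p + q) + b / 2 * (zz - 2 * p' + q')
        = (a + b) / 2 * (zz - 2 * m + w) + (a / 2 * q + b / 2 * q' - (a + b) / 2 * w)"
      if "(a + b) * m = a * p + b * p'" for zz p p' q q' m w :: real
    proof -
      have "a / 2 * (zz - 2 * p + q) + b / 2 * (zz - 2 * p' + q')
        = (a + b) / 2 * zz - (a * p + b * p') + a / 2 * q + b / 2 * q'"
        by (simp add: algebra_simps add_divide_distrib)
      also have "\<dots> = (a + b) / 2 * (zz - 2 * m + w) + (a / 2 * q + b / 2 * q' - (a + b) / 2 * w)"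
        unfolding that[symmetric] by (simp add: algebra_simps add_divide_distrib)
      finally show ?thesis .
    qed
    ultimately show ?thesis unfolding c_def by metis
  qed
  ultimately show ?thesis using that by blast
qed

section \<open>The exponential barrier\<close>

text \<open>A rotationally symmetric bump, positive inside the ball of radius \<open>r\<close> around \<open>x0\<close> and negative outside
  the closed ball. The factor \<open>r\<^sup>2 / \<beta>\<close> makes its Hessian independent of the scale \<open>r\<close>.\<close>

definition exp_barrier :: "real \<Rightarrow> real \<Rightarrow> 'a::real_normed_vector \<Rightarrow> 'a \<Rightarrow> real" where
  "exp_barrier \<beta> r x0 z = r\<^sup>2 / \<beta> * (exp (- \<beta> * (norm (z - x0))\<^sup>2 / r\<^sup>2) - exp (- \<beta>))"

text \<open>The exponential lies above its tangent; in terms of \<open>z\<close> that tangent is a concave paraboloid with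
  vertex exactly at the centre \<open>x0\<close>. This is what turns a contact with the barrier into a contact
  with a paraboloid whose vertex lies in the unit ball.\<close>

lemma exp_barrier_ge_paraboloid:
  fixes z \<xi> x0 :: "'a::real_inner"
  assumes "0 < r" "0 < \<beta>"
  shows "- exp (- \<beta> * (norm (\<xi> - x0))\<^sup>2 / r\<^sup>2) * ((norm (z - x0))\<^sup>2 - (norm (\<xi> - x0))\<^sup>2)
    \<le> exp_barrier \<beta> r x0 z - exp_barrier \<beta> r x0 \<xi>"
proof -
  define a b where "a = - \<beta> * (norm (z - x0))\<^sup>2 / r\<^sup>2" and "b = - \<beta> * (norm (\<xi> - x0))\<^sup>2 / r\<^sup>2"
  have "exp b * (1 + (a - b)) \<le> exp b * exp (a - b)" by (intro mult_left_mono exp_ge_add_one_self) auto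
  also have "\<dots> = exp a" by (simp add: exp_add[symmetric])
  finally have "r\<^sup>2 / \<beta> * (exp b * (a - b)) \<le> r\<^sup>2 / \<beta> * (exp a - exp b)"
    using assms by (intro mult_left_mono) (auto simp: algebra_simps)
  moreover have "r\<^sup>2 / \<beta> * (exp b * (a - b)) = - exp b * ((norm (z - x0))\<^sup>2 - (norm (\<xi> - x0))\<^sup>2)"
    using assms by (simp add: a_def b_def field_simps)
  ultimately show ?thesis by (simp add: a_def b_def exp_barrier_def right_diff_distrib)
qed

text \<open>Away from the centre the barrier is strongly convex in the radial direction \<open>e\<close>: relative to the
  other second derivatives, the radial one carries the extra factor \<open>\<beta>\<close>. Local touching from below by
  a quadratic suffices for viscosity tests; it comes from \<open>1 + t + t\<^sup>2/4 = (1 + t/2)\<^sup>2 \<le> exp t\<close>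
  for \<open>t \<ge> -2\<close>.\<close>

lemma exp_barrier_ge_quadratic:
  fixes z \<xi> x0 :: "'a::real_inner"
  assumes r: "0 < r" and \<beta>: "1 \<le> \<beta>" and v: "r / 2 \<le> norm (\<xi> - x0)" "norm (\<xi> - x0) \<le> r"
    and d: "norm (z - \<xi>) \<le> r / (4 * \<beta>)"
  defines "E \<equiv> exp (- \<beta> * (norm (\<xi> - x0))\<^sup>2 / r\<^sup>2)" and "e \<equiv> (1 / norm (\<xi> - x0)) *\<^sub>R (\<xi> - x0)"
  shows "E * (- 2 * ((\<xi> - x0) \<bullet> (z - \<xi>)) - 2 * (norm (z - \<xi>))\<^sup>2 + \<beta> / 8 * (e \<bullet> (z - \<xi>))\<^sup>2)
    \<le> exp_barrier \<beta> r x0 z - exp_barrier \<beta> r x0 \<xi>"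
proof -
  define a where "a = (\<xi> - x0) \<bullet> (z - \<xi>)"
  define q where "q = (norm (z - \<xi>))\<^sup>2"
  define t where "t = - \<beta> * (2 * a + q) / r\<^sup>2"
  have q0: "0 \<le> q" by (simp add: q_def)
  have "q \<le> (r / (4 * \<beta>))\<^sup>2" unfolding q_def using d by (intro power_mono) auto
  also have "\<dots> = r\<^sup>2 / \<beta> * (1 / (16 * \<beta>))" by (simp add: power2_eq_square)
  also have "\<dots> \<le> r\<^sup>2 / \<beta> * (1 / 16)"
    using \<beta> r by (intro mult_left_mono) (auto simp: field_simps)
  finally have q: "q \<le> r\<^sup>2 / \<beta> / 16" by simp
  have nz: "(norm (z - x0))\<^sup>2 = (norm (\<xi> - x0))\<^sup>2 + 2 * a + q"
    by (simp add: a_def q_def power2_norm_eq_inner inner_simps inner_commute)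
  have "\<bar>a\<bar> \<le> norm (\<xi> - x0) * norm (z - \<xi>)" unfolding a_def by (rule Cauchy_Schwarz_ineq2)
  also have "\<dots> \<le> r * (r / (4 * \<beta>))" using v d r by (intro mult_mono) auto
  finally have a: "\<bar>a\<bar> \<le> r\<^sup>2 / \<beta> / 4" by (simp add: power2_eq_square)
  have "2 * a + q \<le> r\<^sup>2 / \<beta> * 2" using a q q0 by (simp add: abs_le_iff)
  then have "\<beta> * (2 * a + q) / r\<^sup>2 \<le> 2" using \<beta> r by (simp add: field_simps)
  moreover have "t = - (\<beta> * (2 * a + q) / r\<^sup>2)" by (simp add: t_def)
  ultimately have t: "0 \<le> 1 + t / 2" by linarith
  have "1 + t + t\<^sup>2 / 4 = (1 + t / 2)\<^sup>2" by (simp add: power2_eq_square field_simps)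
  also have "\<dots> \<le> (exp (t / 2))\<^sup>2" using t by (intro power_mono exp_ge_add_one_self)
  also have "\<dots> = exp t" by (simp add: exp_double[symmetric])
  finally have et: "t + t\<^sup>2 / 4 \<le> exp t - 1" by simp
  have "2 * a\<^sup>2 - q\<^sup>2 \<le> (2 * a + q)\<^sup>2"
    using zero_le_power2[of "a + 2 * q"] zero_le_power2[of "a"] zero_le_power2[of "a + q"] by (simp add: power2_eq_square algebra_simps)
  moreover have "q\<^sup>2 \<le> q * (4 * (r\<^sup>2 / \<beta>))"
    unfolding power2_eq_square[of q]
  proof (rule mult_left_mono[OF _ q0])
    have *: "X / 16 \<le> 4 * X" if "0 \<le> X" for X :: real using that by simp
    have "0 \<le> r\<^sup>2 / \<beta>" using \<beta> by simp
    then show "q \<le> 4 * (r\<^sup>2 / \<beta>)" using q by (meson * order_trans)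
  qed
  ultimately have "\<beta> / 4 / r\<^sup>2 * (2 * a\<^sup>2 - q * (4 * (r\<^sup>2 / \<beta>))) \<le> \<beta> / 4 / r\<^sup>2 * (2 * a + q)\<^sup>2"
    using \<beta> r by (intro mult_left_mono) auto
  moreover have "\<beta> / 4 / r\<^sup>2 * (2 * a + q)\<^sup>2 = r\<^sup>2 / \<beta> * (t\<^sup>2 / 4)"
    using \<beta> r by (simp add: t_def power2_eq_square field_simps)
  moreover have "\<beta> / 4 / r\<^sup>2 * (2 * a\<^sup>2 - q * (4 * (r\<^sup>2 / \<beta>))) = \<beta> / 2 * (a\<^sup>2 / r\<^sup>2) - q"
    using \<beta> r by (simp add: field_simps)
  moreover have "(e \<bullet> (z - \<xi>))\<^sup>2 / 4 \<le> a\<^sup>2 / r\<^sup>2"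
  proof -
    have v0: "0 < norm (\<xi> - x0)" using v r by linarith
    have "(r / 2)\<^sup>2 \<le> (norm (\<xi> - x0))\<^sup>2" using v r by (intro power_mono) auto
    then have "(r / 2)\<^sup>2 * (e \<bullet> (z - \<xi>))\<^sup>2 \<le> (norm (\<xi> - x0))\<^sup>2 * (e \<bullet> (z - \<xi>))\<^sup>2"
      by (intro mult_right_mono) auto
    also have "\<dots> = a\<^sup>2" using v0 unfolding e_def a_def by (simp add: power_mult_distrib[symmetric])
    finally show ?thesis using r by (simp add: field_simps power2_eq_square)
  qed
  then have "\<beta> / 8 * (e \<bullet> (z - \<xi>))\<^sup>2 \<le> \<beta> / 2 * (a\<^sup>2 / r\<^sup>2)"
    using mult_left_mono[of _ _ "\<beta> / 2"] \<beta> by fastforce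
  moreover have "r\<^sup>2 / \<beta> * t = - (2 * a + q)" using \<beta> r by (simp add: t_def)
  moreover have "r\<^sup>2 / \<beta> * (t + t\<^sup>2 / 4) \<le> r\<^sup>2 / \<beta> * (exp t - 1)"
    using et \<beta> r by (intro mult_left_mono) auto
  ultimately have "- 2 * a - 2 * q + \<beta> / 8 * (e \<bullet> (z - \<xi>))\<^sup>2 \<le> r\<^sup>2 / \<beta> * (exp t - 1)"
    by (simp add: distrib_left)
  then have "E * (- 2 * a - 2 * q + \<beta> / 8 * (e \<bullet> (z - \<xi>))\<^sup>2) \<le> E * (r\<^sup>2 / \<beta> * (exp t - 1))"
    by (intro mult_left_mono) (auto simp: E_def)
  also have "\<dots> = r\<^sup>2 / \<beta> * (E * exp t - E)" by (simp add: algebra_simps)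
  also have "E * exp t = exp (- \<beta> * (norm (z - x0))\<^sup>2 / r\<^sup>2)"
    unfolding E_def nz t_def exp_add[symmetric] by (simp add: add_divide_distrib[symmetric] algebra_simps)
  finally show ?thesis by (simp add: a_def q_def exp_barrier_def E_def right_diff_distrib)
qed

text \<open>Suppose \<open>u\<close> minus the barrier and the paraboloid of opening \<open>K\<close> is touched from below by a
  paraboloid of opening \<open>\<kappa> \<le> K\<close> at a point \<open>\<xi>\<close> of the outer half of the ball. There the barrier
  is a strict subsolution: \<open>\<beta>\<close> is chosen such that its radial second derivative beats its
  other second derivatives and its gradient, and \<open>s\<close> such that the gain also beats the two
  paraboloids with a margin \<open>K\<close>. Hence \<open>K \<le> |D\<phi>|\<^sup>\<gamma> f\<close> at \<open>\<xi>\<close>, and since the gradient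
  is at most of order \<open>K\<close>, the source must be of order \<open>K\<^sup>1\<^sup>-\<^sup>\<gamma>\<close> at \<open>\<xi>\<close>.\<close>

lemma exp_barrier_source:
  fixes lam Lam K \<kappa> :: real and u :: "real^'n \<Rightarrow> real"
  defines "N \<equiv> real CARD('n)"
  defines "\<beta> \<equiv> 4 * (12 * Lam * N + 3) / lam"
  defines "s \<equiv> (6 * Lam * N + 5) * exp \<beta>"
  assumes vis: "viscosity_supersol lam Lam \<gamma> f u" and lam: "0 < lam" "lam \<le> Lam"
    and \<gamma>: "0 \<le> \<gamma>" "\<gamma> < 1" and K: "0 < K" and \<kappa>: "0 \<le> \<kappa>" "\<kappa> \<le> K"
    and r: "0 < r" "r \<le> 1" "ball x0 r \<subseteq> ball 0 1" and y: "y1 \<in> cball 0 1" "y \<in> cball 0 1"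
    and \<xi>: "\<xi> \<in> ball x0 r" "r / 2 \<le> norm (\<xi> - x0)"
    and touch: "\<And>z. z \<in> ball x0 r \<Longrightarrow>
      u \<xi> - (s * K * exp_barrier \<beta> r x0 \<xi> - K / 2 * (norm (\<xi> - y1))\<^sup>2) + \<kappa> / 2 * (norm (\<xi> - y))\<^sup>2
      \<le> u z - (s * K * exp_barrier \<beta> r x0 z - K / 2 * (norm (z - y1))\<^sup>2) + \<kappa> / 2 * (norm (z - y))\<^sup>2"
  shows "1 \<le> (4 + 2 * s) * (K powr (\<gamma> - 1) * \<bar>f \<xi>\<bar>)"
proof -
  have N1: "1 \<le> N" unfolding N_def by (rule one_le_card)
  have LN: "lam \<le> Lam * N" using mult_mono[of lam Lam 1 N] lam N1 by simp
  have \<beta>: "12 \<le> \<beta>" using LN lam by (simp add: \<beta>_def field_simps)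
  have LN0: "0 < Lam * N" using LN lam by linarith
  have s: "0 < s" using LN0 by (simp add: s_def)
  define v where "v = \<xi> - x0"
  define E where "E = exp (- \<beta> * (norm (\<xi> - x0))\<^sup>2 / r\<^sup>2)"
  define e where "e = (1 / norm (\<xi> - x0)) *\<^sub>R (\<xi> - x0)"
  have v0: "0 < norm (\<xi> - x0)" "norm (\<xi> - x0) \<le> r"
    using \<xi> r by (auto simp: dist_norm norm_minus_commute)
  have e: "norm e = 1" using v0 by (simp add: e_def)
  have E: "exp (- \<beta>) \<le> E" "E \<le> 1" "0 < E"
  proof -
    have "(norm (\<xi> - x0))\<^sup>2 \<le> r\<^sup>2" using v0 by (intro power_mono) auto
    then have "(norm (\<xi> - x0))\<^sup>2 / r\<^sup>2 \<le> 1" using r by simp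
    then have "\<beta> * ((norm (\<xi> - x0))\<^sup>2 / r\<^sup>2) \<le> \<beta> * 1"
      using \<beta> by (intro mult_left_mono) auto
    then show "exp (- \<beta>) \<le> E" unfolding E_def by simp
    have "0 \<le> \<beta> * ((norm (\<xi> - x0))\<^sup>2 / r\<^sup>2)" using \<beta> by (intro mult_nonneg_nonneg) auto
    then show "E \<le> 1" by (simp add: E_def)
  qed (simp add: E_def)
  have sE: "6 * Lam * N + 5 \<le> s * E" "s * E \<le> s"
  proof -
    have "6 * Lam * N + 5 = s * exp (- \<beta>)" by (simp add: s_def exp_minus)
    also have "\<dots> \<le> s * E" using E s by (intro mult_left_mono) auto
    finally show "6 * Lam * N + 5 \<le> s * E" .
    show "s * E \<le> s" using mult_left_mono[OF E(2), of s] s by simp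
  qed
  define k where "k = s * K * E"
  have k: "0 < k" using s K E by (simp add: k_def)
  define \<alpha> where "\<alpha> = - K - \<kappa> - 4 * k"
  define p where "p = - K *\<^sub>R (\<xi> - y1) - \<kappa> *\<^sub>R (\<xi> - y) - (2 * k) *\<^sub>R v"
  define S where "S = ball x0 r \<inter> ball \<xi> (r / (4 * \<beta>))"
  have "lam * (k * \<beta> / 4) + 3 * Lam * real CARD('n) * \<alpha> \<le> norm p + norm_pow p \<gamma> * f \<xi>"
  proof (rule viscosity_quadratic_test[OF vis lam e])
    show "\<alpha> \<le> 0" using K \<kappa> k by (simp add: \<alpha>_def)
    show "0 \<le> k * \<beta> / 4" using k \<beta> by simp
    show "open S" "\<xi> \<in> S" "S \<subseteq> ball 0 1" using \<xi> r \<beta> by (auto simp: S_def)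
    fix z assume z: "z \<in> S"
    define h where "h = z - \<xi>"
    have "norm (z - \<xi>) \<le> r / (4 * \<beta>)" using z by (simp add: S_def dist_norm norm_minus_commute)
    then have "E * (- 2 * (v \<bullet> h) - 2 * (norm h)\<^sup>2 + \<beta> / 8 * (e \<bullet> h)\<^sup>2) \<le> exp_barrier \<beta> r x0 z - exp_barrier \<beta> r x0 \<xi>"
      using exp_barrier_ge_quadratic[of r \<beta> \<xi> x0 z] r \<beta> \<xi> v0 unfolding E_def e_def v_def h_def by simp
    then have "s * K * (E * (- 2 * (v \<bullet> h) - 2 * (norm h)\<^sup>2 + \<beta> / 8 * (e \<bullet> h)\<^sup>2)) \<le> s * K * (exp_barrier \<beta> r x0 z - exp_barrier \<beta> r x0 \<xi>)"
      using s K by (intro mult_left_mono) auto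
    then have b: "k * (- 2 * (v \<bullet> h) - 2 * (norm h)\<^sup>2 + \<beta> / 8 * (e \<bullet> h)\<^sup>2) \<le> s * K * exp_barrier \<beta> r x0 z - s * K * exp_barrier \<beta> r x0 \<xi>"
      by (simp add: k_def algebra_simps)
    have n: "(norm (z - w))\<^sup>2 = (norm (\<xi> - w))\<^sup>2 + 2 * ((\<xi> - w) \<bullet> h) + (norm h)\<^sup>2" for w
      by (simp add: h_def power2_norm_eq_inner inner_simps inner_commute)
    have "u \<xi> + k * (- 2 * (v \<bullet> h) - 2 * (norm h)\<^sup>2 + \<beta> / 8 * (e \<bullet> h)\<^sup>2)
        - K / 2 * (2 * ((\<xi> - y1) \<bullet> h) + (norm h)\<^sup>2) - \<kappa> / 2 * (2 * ((\<xi> - y) \<bullet> h) + (norm h)\<^sup>2) \<le> u z"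
      using touch[of z] z b unfolding n S_def by (simp add: distrib_left)
    moreover have "u \<xi> + k * (- 2 * (v \<bullet> h) - 2 * (norm h)\<^sup>2 + \<beta> / 8 * (e \<bullet> h)\<^sup>2)
        - K / 2 * (2 * ((\<xi> - y1) \<bullet> h) + (norm h)\<^sup>2) - \<kappa> / 2 * (2 * ((\<xi> - y) \<bullet> h) + (norm h)\<^sup>2)
       = u \<xi> + p \<bullet> h + \<alpha> / 2 * (norm h)\<^sup>2 + k * \<beta> / 4 / 2 * (e \<bullet> h)\<^sup>2"
      unfolding p_def \<alpha>_def inner_diff_left inner_scaleR_left inner_minus_left by (simp add: field_simps)
    ultimately show "u \<xi> + p \<bullet> (z - \<xi>) + \<alpha> / 2 * (norm (z - \<xi>))\<^sup>2 + k * \<beta> / 4 / 2 * (e \<bullet> (z - \<xi>))\<^sup>2 \<le> u z"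
      by (simp add: h_def)
  qed
  moreover have "lam * (k * \<beta> / 4) = 12 * Lam * N * k + 3 * k" using lam by (simp add: \<beta>_def field_simps)
  moreover have "3 * Lam * real CARD('n) * \<alpha> \<ge> - (6 * Lam * N * K) - 12 * Lam * N * k"
  proof -
    have "3 * Lam * N * (K + \<kappa> + 4 * k) \<le> 3 * Lam * N * (2 * K + 4 * k)"
      using \<kappa> LN0 by (intro mult_left_mono) (auto simp: mult.assoc)
    then show ?thesis unfolding \<alpha>_def N_def by (simp add: algebra_simps)
  qed
  moreover have \<xi>1: "norm \<xi> \<le> 1" "norm y \<le> 1" "norm y1 \<le> 1"
    using \<xi> r(3) y by (auto simp: less_imp_le dest!: subsetD)
  have p: "norm p \<le> 4 * K + 2 * k"
  proof -
    have "norm p \<le> norm (K *\<^sub>R (\<xi> - y1)) + norm (\<kappa> *\<^sub>R (\<xi> - y)) + norm ((2 * k) *\<^sub>R v)"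
      unfolding p_def by (metis (no_types) norm_minus_cancel norm_triangle_ineq4 add_mono order_trans order_refl scaleR_minus_left)
    also have "\<dots> \<le> K * 2 + K * 2 + 2 * k * 1"
    proof (intro add_mono)
      have "norm (\<xi> - y1) \<le> 2" "norm (\<xi> - y) \<le> 2"
        using \<xi>1 norm_triangle_ineq4[of \<xi> y1] norm_triangle_ineq4[of \<xi> y] by linarith+
      then show "norm (K *\<^sub>R (\<xi> - y1)) \<le> K * 2" "norm (\<kappa> *\<^sub>R (\<xi> - y)) \<le> K * 2"
        using K \<kappa> by (auto intro: mult_mono)
      have "norm v \<le> 1" using v0 r by (simp add: v_def)
      then show "norm ((2 * k) *\<^sub>R v) \<le> 2 * k * 1" using k by simp
    qed
    finally show ?thesis by simp
  qed
  ultimately have "k - 6 * Lam * N * K - 4 * K \<le> norm_pow p \<gamma> * f \<xi>" by linarith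
  moreover have "(6 * Lam * N + 5) * K \<le> k"
    using mult_right_mono[OF sE(1), of K] K by (simp add: k_def mult_ac)
  ultimately have "K \<le> norm_pow p \<gamma> * f \<xi>" by (simp add: algebra_simps)
  also have "\<dots> \<le> norm_pow p \<gamma> * \<bar>f \<xi>\<bar>"
    by (intro mult_left_mono) (auto simp: norm_pow_def)
  also have "\<dots> \<le> (4 + 2 * s) * K powr \<gamma> * \<bar>f \<xi>\<bar>"
  proof (intro mult_right_mono norm_pow_le)
    have "k \<le> s * K" using mult_right_mono[OF sE(2), of K] K by (simp add: k_def mult_ac)
    then show "norm p \<le> (4 + 2 * s) * K" using p by (simp add: algebra_simps)
  qed (use s K \<gamma> in auto)
  also have "K powr \<gamma> = K * K powr (\<gamma> - 1)" using K by (simp add: powr_diff)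
  finally have "K * 1 \<le> K * ((4 + 2 * s) * (K powr (\<gamma> - 1) * \<bar>f \<xi>\<bar>))" by (simp add: mult_ac)
  then show ?thesis using K by (simp only: mult_le_cancel_left_pos)
qed

section \<open>From the boundary to the centre\<close>

lemma set_nn_integral_measurable:
  fixes f :: "real^'n \<Rightarrow> real"
  assumes B: "open B" and f: "continuous_on B f"
  shows "(\<lambda>x. ennreal (\<bar>f x\<bar> ^ m) * indicator B x) \<in> borel_measurable lebesgue"
proof -
  have "(\<lambda>x. indicator B x *\<^sub>R (\<bar>f x\<bar> ^ m)) \<in> borel_measurable borel"
    using B by (intro borel_measurable_continuous_on_indicator continuous_intros f) auto
  then have "(\<lambda>x. ennreal (indicator B x *\<^sub>R (\<bar>f x\<bar> ^ m))) \<in> borel_measurable lebesgue"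
    by (auto intro!: measurable_completion)
  moreover have "(\<lambda>x. ennreal (indicator B x *\<^sub>R (\<bar>f x\<bar> ^ m))) = (\<lambda>x. ennreal (\<bar>f x\<bar> ^ m) * indicator B x)"
    by (auto simp: fun_eq_iff indicator_def)
  ultimately show ?thesis by metis
qed

lemma set_nn_integral_cmult_abs_power:
  fixes f :: "real^'n \<Rightarrow> real"
  assumes B: "open B" and f: "continuous_on B f" and c: "0 \<le> c"
  shows "(\<integral>\<^sup>+x\<in>B. ennreal (c * \<bar>f x\<bar> ^ m) \<partial>lebesgue) = ennreal c * (\<integral>\<^sup>+x\<in>B. ennreal (\<bar>f x\<bar> ^ m) \<partial>lebesgue)"
proof -
  have "(\<integral>\<^sup>+x\<in>B. ennreal (c * \<bar>f x\<bar> ^ m) \<partial>lebesgue) = (\<integral>\<^sup>+x. ennreal c * (ennreal (\<bar>f x\<bar> ^ m) * indicator B x) \<partial>lebesgue)"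
    using c by (intro nn_integral_cong) (simp add: ennreal_mult mult.assoc)
  also have "\<dots> = ennreal c * (\<integral>\<^sup>+x\<in>B. ennreal (\<bar>f x\<bar> ^ m) \<partial>lebesgue)"
    by (rule nn_integral_cmult[OF set_nn_integral_measurable[OF B f]])
  finally show ?thesis .
qed

text \<open>Below \<open>u\<close> lies a paraboloid touching it at a point \<open>x1\<close> that is not too close to the boundary
  of \<open>ball x0 r\<close>. Adding the barrier raises it above \<open>u\<close> at \<open>x1\<close> but not outside the ball. So for
  every \<open>y \<in> cball x0 r\<close> a further paraboloid with vertex \<open>y\<close> and small opening produces
  a contact point inside the ball. If one of these lies within \<open>r / 2\<close> of the centre, it belongs to
  the contact set of opening \<open>K (2 + 2 s)\<close>. Otherwise \<open>f\<close> is bounded below at all of them, the term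
  \<open>1\<close> in the weight of the area estimate is absorbed by \<open>|f|\<close>, and the whole ball of
  vertices is bounded by the integral of \<open>|f|\<^sup>n\<close> alone.\<close>

lemma contact_point_or_large_source:
  fixes lam Lam K \<delta> :: real and u f :: "real^'n \<Rightarrow> real"
  defines "N \<equiv> real CARD('n)"
  defines "\<beta> \<equiv> 4 * (12 * Lam * N + 3) / lam"
  defines "s \<equiv> (6 * Lam * N + 5) * exp \<beta>"
  defines "c \<equiv> 4 * (4 + 2 * s) / \<delta>"
  defines "C \<equiv> 16 / lam * (3 * Lam * N * (c + 1) + c + 4)"
  assumes vis: "viscosity_supersol lam Lam \<gamma> f u" and lam: "0 < lam" "lam \<le> Lam"
    and \<gamma>: "0 \<le> \<gamma>" "\<gamma> < 1" and f: "continuous_on (ball 0 1) f" and u: "continuous_on (cball 0 1) u"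
    and K: "0 < K" and \<delta>: "0 < \<delta>" "\<delta> < 1" and r: "0 < r" "ball x0 r \<subseteq> ball 0 1"
    and x1: "x1 \<in> contact_set K u" "norm (x1 - x0) \<le> (1 - \<delta>) * r"
    and none: "cball x0 (r / 2) \<inter> contact_set (K * (2 + 2 * s)) u = {}"
  shows "emeasure lebesgue (cball x0 r) \<le>
     ennreal (2 * (4 * N * C) ^ CARD('n) * (4 + 2 * s + 4 / \<delta>) ^ CARD('n) * (K powr (\<gamma> - 1)) ^ CARD('n))
       * (\<integral>\<^sup>+x\<in>ball x0 r. ennreal (\<bar>f x\<bar> ^ CARD('n)) \<partial>lebesgue)"
proof -
  let ?n = "CARD('n)"
  have N1: "1 \<le> N" unfolding N_def by (rule one_le_card)
  have LN: "lam \<le> Lam * N" using mult_mono[of lam Lam 1 N] lam N1 by simp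
  have \<beta>: "12 \<le> \<beta>" using LN lam by (simp add: \<beta>_def field_simps)
  have LN0: "0 < Lam * N" using LN lam by linarith
  have s: "0 < s" using LN0 by (simp add: s_def)
  have c: "0 \<le> c" using s \<delta> by (simp add: c_def)
  have C: "0 \<le> C" using lam c N1 by (simp add: C_def)
  \<comment> \<open>At distance \<open>\<delta> r\<close> from the boundary the barrier has height at least \<open>\<delta> K r\<^sup>2\<close>. With this opening
    the additional paraboloid varies by at most half of it on the ball.\<close>
  define \<kappa> where "\<kappa> = \<delta> * K / 4"
  have \<kappa>: "0 < \<kappa>" "\<kappa> \<le> K"
    using \<delta> K by (auto simp: \<kappa>_def mult_left_le_one_le intro: order_trans[of _ "\<delta> * K"])
  have c\<kappa>: "c * \<kappa> = (4 + 2 * s) * K" using \<delta> by (simp add: c_def \<kappa>_def)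
  have cb: "cball x0 r \<subseteq> cball 0 1"
    using closure_mono[OF r(2)] r(1) by simp
  have r1: "r \<le> 1"
  proof -
    have "dist x0 0 + r \<le> 1 \<or> r < 0" using cb by (simp add: cball_subset_cball_iff)
    then show ?thesis using r(1) zero_le_dist[of x0 0] by linarith
  qed
  obtain y1 where y1: "y1 \<in> cball 0 1" and
    t1: "\<And>z. z \<in> cball 0 1 \<Longrightarrow> u x1 + K / 2 * (norm (x1 - y1))\<^sup>2 \<le> u z + K / 2 * (norm (z - y1))\<^sup>2"
    using x1(1) mem_contact_set_iff[OF u] by blast
  define m where "m = u x1 + K / 2 * (norm (x1 - y1))\<^sup>2"
  define b where "b = exp_barrier \<beta> r x0"
  define G where "G z = s * K * b z - K / 2 * (norm (z - y1))\<^sup>2" for z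
  define E where "E \<xi> = exp (- \<beta> * (norm (\<xi> - x0))\<^sup>2 / r\<^sup>2)" for \<xi>
  have E: "0 < E \<xi>" "E \<xi> \<le> 1" for \<xi>
  proof -
    have "0 \<le> \<beta> * ((norm (\<xi> - x0))\<^sup>2 / r\<^sup>2)" using \<beta> by (intro mult_nonneg_nonneg) auto
    then show "E \<xi> \<le> 1" by (simp add: E_def)
  qed (simp add: E_def)
  have sE: "0 < s * E \<xi>" "s * E \<xi> \<le> s" for \<xi>
    using mult_left_mono[OF E(2)[of \<xi>], of s] s E(1)[of \<xi>] by auto
  have sKE: "s * K * E \<xi> \<le> s * K" for \<xi> using mult_right_mono[OF sE(2)[of \<xi>], of K] K by (simp add: mult_ac)
  have Gc: "continuous_on X G" for X unfolding G_def b_def exp_barrier_def by (intro continuous_intros) (use r in auto)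
  have Glow: "G z - G \<xi> \<ge> - (K / 2 * ((norm (z - y1))\<^sup>2 - (norm (\<xi> - y1))\<^sup>2))
      - (2 * (s * K * E \<xi>)) / 2 * ((norm (z - x0))\<^sup>2 - (norm (\<xi> - x0))\<^sup>2)" for z \<xi>
  proof -
    have "s * K * (- E \<xi> * ((norm (z - x0))\<^sup>2 - (norm (\<xi> - x0))\<^sup>2)) \<le> s * K * (b z - b \<xi>)"
      unfolding E_def b_def using s K r \<beta> by (intro mult_left_mono exp_barrier_ge_paraboloid) auto
    then show ?thesis unfolding G_def by (simp add: algebra_simps)
  qed
  have bneg: "b z \<le> 0" if "r \<le> norm (z - x0)" for z
  proof -
    have "r\<^sup>2 \<le> (norm (z - x0))\<^sup>2" using that r by (intro power_mono) auto
    then have "\<beta> * 1 \<le> \<beta> * ((norm (z - x0))\<^sup>2 / r\<^sup>2)"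
      using \<beta> r by (intro mult_left_mono) auto
    then have "exp (- \<beta> * (norm (z - x0))\<^sup>2 / r\<^sup>2) - exp (- \<beta>) \<le> 0" by simp
    then show ?thesis unfolding b_def exp_barrier_def using \<beta> by (intro mult_nonneg_nonpos) auto
  qed
  have bpos: "\<delta> * r\<^sup>2 \<le> s * b x1"
  proof -
    define q where "q = (norm (x1 - x0))\<^sup>2 / r\<^sup>2"
    have "(norm (x1 - x0))\<^sup>2 \<le> ((1 - \<delta>) * r)\<^sup>2" using x1(2) by (intro power_mono) auto
    then have "q \<le> (1 - \<delta>)\<^sup>2" using r by (simp add: q_def divide_le_eq power_mult_distrib)
    also have "\<dots> \<le> 1 - \<delta>" using \<delta> by (simp add: power2_eq_square mult_left_le)
    finally have q: "\<delta> \<le> 1 - q" by simp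
    have "exp (- \<beta>) * (1 + \<beta> * (1 - q)) \<le> exp (- \<beta>) * exp (\<beta> * (1 - q))"
      by (intro mult_left_mono exp_ge_add_one_self) auto
    also have "\<dots> = exp (- \<beta> * q)" by (simp add: exp_add[symmetric] algebra_simps)
    finally have "exp (- \<beta>) * (\<beta> * (1 - q)) \<le> exp (- \<beta> * q) - exp (- \<beta>)"
      by (simp add: algebra_simps)
    then have "r\<^sup>2 / \<beta> * (exp (- \<beta>) * (\<beta> * (1 - q))) \<le> b x1"
      unfolding b_def exp_barrier_def q_def using \<beta> r by (intro mult_left_mono) auto
    then have "r\<^sup>2 * exp (- \<beta>) * (1 - q) \<le> b x1" using \<beta> by simp
    then have "s * (r\<^sup>2 * exp (- \<beta>) * (1 - q)) \<le> s * b x1" using s by (intro mult_left_mono) auto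
    moreover have "s * (r\<^sup>2 * exp (- \<beta>) * (1 - q)) = (6 * Lam * N + 5) * (r\<^sup>2 * (1 - q))"
      by (simp add: s_def exp_minus field_simps)
    moreover have "1 * (r\<^sup>2 * \<delta>) \<le> (6 * Lam * N + 5) * (r\<^sup>2 * (1 - q))"
      using LN0 q \<delta> by (intro mult_mono) (auto simp: mult.assoc)
    ultimately have "1 * (r\<^sup>2 * \<delta>) \<le> s * b x1" by (metis order_trans)
    then show ?thesis by (simp add: mult.commute)
  qed
  define F where "F y z = u z - G z + \<kappa> / 2 * (norm (z - y))\<^sup>2" for y z
  \<comment> \<open>The minimum over the closed ball beats the values outside, where the barrier is not positive.\<close>
  have min: "\<exists>x\<in>ball x0 r. \<forall>z\<in>cball 0 1. F y x \<le> F y z" if y: "y \<in> cball x0 r" for y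
  proof -
    have "continuous_on (cball x0 r) (F y)" unfolding F_def
      by (intro continuous_intros Gc continuous_on_subset[OF u cb])
    then obtain x where x: "x \<in> cball x0 r" "\<And>z. z \<in> cball x0 r \<Longrightarrow> F y x \<le> F y z"
      using continuous_attains_inf[of "cball x0 r" "F y"] r by auto
    have x1c: "x1 \<in> cball x0 r"
    proof -
      have "(1 - \<delta>) * r \<le> r" using r \<delta> by (simp add: mult_left_le_one_le)
      then show ?thesis using x1(2) by (simp add: dist_norm norm_minus_commute)
    qed
    have "norm (x1 - y) \<le> 2 * r"
      using x1c y norm_triangle_ineq4[of "x1 - x0" "y - x0"] by (simp add: dist_norm norm_minus_commute)
    then have "(norm (x1 - y))\<^sup>2 \<le> (2 * r)\<^sup>2" by (intro power_mono) auto
    then have "\<kappa> / 2 * (norm (x1 - y))\<^sup>2 \<le> \<kappa> / 2 * (2 * r)\<^sup>2"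
      using \<kappa> by (intro mult_left_mono) auto
    also have "\<dots> = K * (\<delta> * r\<^sup>2) / 2" by (simp add: \<kappa>_def power2_eq_square)
    finally have "F y x1 \<le> m - s * K * b x1 + K * (\<delta> * r\<^sup>2) / 2" by (simp add: F_def G_def m_def)
    moreover have "K * (\<delta> * r\<^sup>2) \<le> s * K * b x1"
      using mult_left_mono[OF bpos, of K] K by (simp add: mult_ac)
    moreover have "0 < K * (\<delta> * r\<^sup>2)" using K \<delta> r by simp
    ultimately have neg: "F y x1 < m" by linarith
    have out: "m \<le> F y z" if z: "z \<in> cball 0 1" "r \<le> norm (z - x0)" for z
    proof -
      have "s * K * b z \<le> 0" using bneg[OF z(2)] s K by (intro mult_nonneg_nonpos) auto
      moreover have "0 \<le> \<kappa> / 2 * (norm (z - y))\<^sup>2" using \<kappa> by simp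
      ultimately show ?thesis using t1[OF z(1)] by (simp add: F_def G_def m_def)
    qed
    have xm: "F y x < m" using x(2)[OF x1c] neg by linarith
    show ?thesis
    proof (rule bexI[of _ x])
      show "x \<in> ball x0 r" using x(1) out[of x] xm cb by (force simp: dist_norm norm_minus_commute)
      show "\<forall>z\<in>cball 0 1. F y x \<le> F y z"
        using x(2) out xm by (force simp: dist_norm norm_minus_commute)
    qed
  qed
  \<comment> \<open>Near the centre the barrier is replaced by a paraboloid below it; all the paraboloids then add up to one.\<close>
  have far: "r / 2 < norm (x - x0)"
    if x: "x \<in> ball x0 r" "\<forall>z\<in>cball 0 1. F y x \<le> F y z" and y: "y \<in> cball x0 r" for x y
  proof (rule ccontr)
    assume near: "\<not> r / 2 < norm (x - x0)"
    define k where "k = s * K * E x"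
    have k: "0 < k" "k \<le> s * K" using s K E sKE by (auto simp: k_def)
    have "x0 \<in> cball x0 r" "x \<in> cball x0 r" using r x by auto
    then have y': "y \<in> cball 0 1" "x0 \<in> cball 0 1" "x \<in> cball 0 1" using y cb by blast+
    obtain w1 c1 where w1: "w1 \<in> cball 0 1"
      "\<And>z. K / 2 * (norm (z - y1))\<^sup>2 + \<kappa> / 2 * (norm (z - y))\<^sup>2 = (K + \<kappa>) / 2 * (norm (z - w1))\<^sup>2 + c1"
      using add_paraboloids[of K \<kappa> y1 y] K \<kappa> y1 y' by auto
    obtain w2 c2 where w2: "w2 \<in> cball 0 1"
      "\<And>z. (K + \<kappa>) / 2 * (norm (z - w1))\<^sup>2 + (2 * k) / 2 * (norm (z - x0))\<^sup>2 = (K + \<kappa> + 2 * k) / 2 * (norm (z - w2))\<^sup>2 + c2"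
      using add_paraboloids[of "K + \<kappa>" "2 * k" w1 x0] K \<kappa> w1 y' k by auto
    \<comment> \<open>A last paraboloid with vertex at the contact point itself fills the opening up to \<open>K (2 + 2 s)\<close>.\<close>
    define l where "l = K * (2 + 2 * s) - (K + \<kappa> + 2 * k)"
    have l: "0 \<le> l" using k \<kappa> by (simp add: l_def algebra_simps)
    obtain w3 c3 where w3: "w3 \<in> cball 0 1"
      "\<And>z. (K + \<kappa> + 2 * k) / 2 * (norm (z - w2))\<^sup>2 + l / 2 * (norm (z - x))\<^sup>2 = (K + \<kappa> + 2 * k + l) / 2 * (norm (z - w3))\<^sup>2 + c3"
      using add_paraboloids[of "K + \<kappa> + 2 * k" l w2 x] K \<kappa> w2 y' k l by auto
    have l': "K + \<kappa> + 2 * k + l = K * (2 + 2 * s)" by (simp add: l_def)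
    have sum: "K / 2 * (norm (z - y1))\<^sup>2 + \<kappa> / 2 * (norm (z - y))\<^sup>2 + (2 * k) / 2 * (norm (z - x0))\<^sup>2 + l / 2 * (norm (z - x))\<^sup>2
       = K * (2 + 2 * s) / 2 * (norm (z - w3))\<^sup>2 + (c1 + c2 + c3)" for z
      using w1(2)[of z] w2(2)[of z] w3(2)[of z] unfolding l' by linarith
    have "u x + K * (2 + 2 * s) / 2 * (norm (x - w3))\<^sup>2 \<le> u z + K * (2 + 2 * s) / 2 * (norm (z - w3))\<^sup>2" if z: "z \<in> cball 0 1" for z
    proof -
      have "F y x \<le> F y z" using x(2) z by auto
      then have "u x + (G z - G x) + \<kappa> / 2 * (norm (x - y))\<^sup>2 \<le> u z + \<kappa> / 2 * (norm (z - y))\<^sup>2"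
        by (simp add: F_def)
      moreover have "0 \<le> l / 2 * (norm (z - x))\<^sup>2" using l by simp
      moreover have "l / 2 * (norm (x - x))\<^sup>2 = 0" by simp
      ultimately show ?thesis using Glow[where z = z and \<xi> = x] sum[of z] sum[of x]
        unfolding k_def[symmetric] right_diff_distrib by linarith
    qed
    then have "x \<in> contact_set (K * (2 + 2 * s)) u"
      using mem_contact_set_iff[OF u] w3(1) x(1) r(2) by blast
    moreover have "x \<in> cball x0 (r / 2)" using near by (simp add: dist_norm norm_minus_commute)
    ultimately show False using none by blast
  qed
  define c5 where "c5 = 4 + 2 * s + 4 / \<delta>"
  define h where "h x = (c5 * K powr (\<gamma> - 1)) ^ ?n * \<bar>f x\<bar> ^ ?n" for x
  have f': "continuous_on (ball x0 r) f" using f r(2) continuous_on_subset by blast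
  have c5: "0 \<le> c5" using s \<delta> by (simp add: c5_def)
  define g where "g \<xi> = - K *\<^sub>R (\<xi> - y1) - (2 * (s * K * E \<xi>)) *\<^sub>R (\<xi> - x0)" for \<xi>
  have "emeasure lebesgue (cball x0 r) \<le> ennreal (2 * (4 * N * C) ^ ?n) * (\<integral>\<^sup>+x\<in>ball x0 r. ennreal (h x) \<partial>lebesgue)"
    unfolding N_def C_def
  proof (rule emeasure_vertices_le[OF vis lam \<gamma> f' open_ball r(2), where \<kappa> = \<kappa> and g = g and G = G and c = c and A = "{x \<in> ball x0 r. r / 2 < norm (x - x0)}"])
    show "continuous_on (ball x0 r) u" using u cb ball_subset_cball continuous_on_subset by (metis subset_trans)
    show "continuous_on (ball x0 r) G" by (rule Gc)
    fix x \<xi> assume xi: "x \<in> ball x0 r" "\<xi> \<in> ball x0 r"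
    have n: "(norm (x - w))\<^sup>2 - (norm (\<xi> - w))\<^sup>2 = 2 * ((\<xi> - w) \<bullet> (x - \<xi>)) + (norm (x - \<xi>))\<^sup>2" for w
      by (simp add: power2_norm_eq_inner inner_simps inner_commute)
    have "g \<xi> \<bullet> (x - \<xi>) - (K + 2 * (s * K * E \<xi>)) / 2 * (norm (x - \<xi>))\<^sup>2 \<le> G x - G \<xi>"
      using Glow[where z = x and \<xi> = \<xi>] unfolding n g_def inner_diff_left[of "- K *\<^sub>R (\<xi> - y1)"] inner_scaleR_left inner_minus_left
      by (simp add: field_simps)
    moreover have "(K + 2 * (s * K * E \<xi>)) / 2 * (norm (x - \<xi>))\<^sup>2 \<le> c * \<kappa> / 2 * (norm (x - \<xi>))\<^sup>2"
    proof (rule mult_right_mono)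
      show "(K + 2 * (s * K * E \<xi>)) / 2 \<le> c * \<kappa> / 2"
      proof -
        have "(4 + 2 * s) * K = 4 * K + 2 * (s * K)" by (simp add: algebra_simps)
        then have "c * \<kappa> = 4 * K + 2 * (s * K)" unfolding c\<kappa> .
        then show ?thesis using mult_left_mono[OF sKE[of \<xi>], of 2] K by (auto intro!: divide_right_mono)
      qed
    qed simp
    ultimately show "G \<xi> + g \<xi> \<bullet> (x - \<xi>) - c * \<kappa> / 2 * (norm (x - \<xi>))\<^sup>2 \<le> G x"
      by linarith
  next
    fix \<xi> assume xi: "\<xi> \<in> ball x0 r"
    have "\<xi> \<in> ball 0 1" using xi r(2) by blast
    then have n: "norm \<xi> \<le> 1" "norm y1 \<le> 1" "norm (\<xi> - x0) \<le> 1"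
      using xi y1 r1 by (auto simp: dist_norm norm_minus_commute)
    have "norm (g \<xi>) \<le> norm (K *\<^sub>R (\<xi> - y1)) + norm ((2 * (s * K * E \<xi>)) *\<^sub>R (\<xi> - x0))"
      unfolding g_def by (metis norm_minus_cancel norm_triangle_ineq4 scaleR_minus_left)
    also have "\<dots> \<le> K * 2 + 2 * (s * K) * 1"
    proof (intro add_mono)
      show "norm (K *\<^sub>R (\<xi> - y1)) \<le> K * 2" using K n norm_triangle_ineq4[of \<xi> y1] by simp
      have "norm ((2 * (s * K * E \<xi>)) *\<^sub>R (\<xi> - x0)) = 2 * (s * K * E \<xi>) * norm (\<xi> - x0)"
        using s K E(1)[of \<xi>] by (simp add: abs_mult)
      also have "\<dots> \<le> 2 * (s * K) * 1"
      proof (rule mult_mono)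
        show "2 * (s * K * E \<xi>) \<le> 2 * (s * K)" by (rule mult_left_mono[OF sKE]) simp
      qed (use n s K in auto)
      finally show "norm ((2 * (s * K * E \<xi>)) *\<^sub>R (\<xi> - x0)) \<le> 2 * (s * K) * 1" .
    qed
    finally show "norm (g \<xi>) \<le> c * \<kappa>" unfolding c\<kappa> using K by (simp add: algebra_simps)
  next
    show "0 \<le> c" "0 < \<kappa>" "cball x0 r \<subseteq> cball 0 1" by (fact c \<kappa> cb)+
    show "continuous_on (ball x0 r) h" unfolding h_def by (intro continuous_intros f')
  next
    fix y assume y: "y \<in> cball x0 r"
    then obtain x where x: "x \<in> ball x0 r" "\<forall>z\<in>cball 0 1. F y x \<le> F y z" using min by blast
    have "\<forall>z\<in>ball x0 r. F y x \<le> F y z" using x(2) cb ball_subset_cball by blast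
    then show "\<exists>x\<in>{x \<in> ball x0 r. r / 2 < norm (x - x0)}. \<forall>z\<in>ball x0 r.
       u x - G x + \<kappa> / 2 * (norm (x - y))\<^sup>2 \<le> u z - G z + \<kappa> / 2 * (norm (z - y))\<^sup>2"
      using far[OF x y] x(1) unfolding F_def by blast
  next
    fix x y assume x: "x \<in> {x \<in> ball x0 r. r / 2 < norm (x - x0)}" and y: "y \<in> cball x0 r"
      and touch: "\<forall>z\<in>ball x0 r. u x - G x + \<kappa> / 2 * (norm (x - y))\<^sup>2 \<le> u z - G z + \<kappa> / 2 * (norm (z - y))\<^sup>2"
    have "1 \<le> (4 + 2 * s) * (K powr (\<gamma> - 1) * \<bar>f x\<bar>)"
    proof (rule exp_barrier_source[OF vis lam \<gamma> K less_imp_le[OF \<kappa>(1)] \<kappa>(2) r(1) r1 r(2) y1, folded N_def, folded \<beta>_def, folded s_def])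
      show "y \<in> cball 0 1" using y cb by auto
      show "x \<in> ball x0 r" "r / 2 \<le> norm (x - x0)" using x by auto
      show "u x - (s * K * exp_barrier \<beta> r x0 x - K / 2 * (norm (x - y1))\<^sup>2) + \<kappa> / 2 * (norm (x - y))\<^sup>2
        \<le> u z - (s * K * exp_barrier \<beta> r x0 z - K / 2 * (norm (z - y1))\<^sup>2) + \<kappa> / 2 * (norm (z - y))\<^sup>2" if "z \<in> ball x0 r" for z
        using touch that unfolding G_def b_def by blast
    qed
    moreover have "\<kappa> powr (\<gamma> - 1) * \<bar>f x\<bar> \<le> 4 / \<delta> * (K powr (\<gamma> - 1) * \<bar>f x\<bar>)"
    proof -
      have "\<kappa> powr (\<gamma> - 1) = (\<delta> / 4) powr (\<gamma> - 1) * K powr (\<gamma> - 1)"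
        using \<delta> K by (simp add: \<kappa>_def powr_mult[symmetric])
      also have "(\<delta> / 4) powr (\<gamma> - 1) \<le> (\<delta> / 4) powr (- 1)"
        using \<delta> \<gamma> by (intro powr_mono') auto
      also have "(\<delta> / 4) powr (- 1) = 4 / \<delta>" using \<delta> by (simp add: powr_minus_divide)
      finally have "\<kappa> powr (\<gamma> - 1) \<le> 4 / \<delta> * K powr (\<gamma> - 1)"
        by (simp add: mult_right_mono)
      then have "\<kappa> powr (\<gamma> - 1) * \<bar>f x\<bar> \<le> 4 / \<delta> * K powr (\<gamma> - 1) * \<bar>f x\<bar>"
        by (rule mult_right_mono) simp
      then show ?thesis by (simp only: mult.assoc)
    qed
    ultimately have "1 + \<kappa> powr (\<gamma> - 1) * \<bar>f x\<bar> \<le> c5 * K powr (\<gamma> - 1) * \<bar>f x\<bar>"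
      by (simp add: c5_def algebra_simps)
    then have "(1 + \<kappa> powr (\<gamma> - 1) * \<bar>f x\<bar>) ^ ?n \<le> (c5 * K powr (\<gamma> - 1) * \<bar>f x\<bar>) ^ ?n"
      by (intro power_mono) auto
    then show "(1 + \<kappa> powr (\<gamma> - 1) * \<bar>f x\<bar>) ^ ?n \<le> h x"
      by (simp add: h_def power_mult_distrib)
  qed auto
  also have "(\<integral>\<^sup>+x\<in>ball x0 r. ennreal (h x) \<partial>lebesgue) =
      ennreal ((c5 * K powr (\<gamma> - 1)) ^ ?n) * (\<integral>\<^sup>+x\<in>ball x0 r. ennreal (\<bar>f x\<bar> ^ ?n) \<partial>lebesgue)"
    unfolding h_def using c5 by (intro set_nn_integral_cmult_abs_power f') auto
  finally show ?thesis
    using c5 C N1 unfolding c5_def by (simp add: ennreal_mult power_mult_distrib mult.assoc)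
qed

section \<open>From a contact point to positive density\<close>

lemma power_one_add_le:
  fixes t :: real
  assumes "0 \<le> t"
  shows "(1 + t) ^ m \<le> 2 ^ m * (1 + t ^ m)"
proof -
  have "(1 + t) ^ m \<le> (2 * max 1 t) ^ m" using assms by (intro power_mono) auto
  also have "\<dots> = 2 ^ m * max 1 t ^ m" by (simp add: power_mult_distrib)
  also have "max 1 t ^ m \<le> 1 + t ^ m" using assms by (cases "t \<le> 1") (auto simp: max_def)
  finally show ?thesis by simp
qed

text \<open>A contact point \<open>x2\<close> near the centre is surrounded by many contact points of twice the opening: add
  a second paraboloid of opening \<open>K\<close> with vertex \<open>y\<close> near \<open>x2\<close>. Since \<open>u\<close> minus the first one vanishes at
  \<open>x2\<close> and is nonnegative, the new contact point is at least as close to \<open>y\<close> as \<open>x2\<close> is, so it lies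
  in \<open>ball x0 r\<close>. The area estimate for this ball of vertices bounds the contact set from below, up
  to the integral of \<open>|f|\<^sup>n\<close>.\<close>

lemma contact_set_spreads:
  fixes lam Lam K :: real and u f :: "real^'n \<Rightarrow> real"
  defines "N \<equiv> real CARD('n)"
  defines "C \<equiv> 16 / lam * (3 * Lam * N * (2 + 1) + 2 + 4)"
  assumes vis: "viscosity_supersol lam Lam \<gamma> f u" and lam: "0 < lam" "lam \<le> Lam"
    and \<gamma>: "0 \<le> \<gamma>" "\<gamma> < 1" and f: "continuous_on (ball 0 1) f" and u: "continuous_on (cball 0 1) u"
    and K: "0 < K" and r: "0 < r" "ball x0 r \<subseteq> ball 0 1"
    and x2: "x2 \<in> contact_set K u" "x2 \<in> cball x0 (r / 2)"
    and U: "open U" "ball x0 r \<inter> contact_set (2 * K) u \<subseteq> U" "U \<subseteq> ball x0 r"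
  shows "emeasure lebesgue (cball x2 (r / 8)) \<le> ennreal (2 * (4 * N * C) ^ CARD('n) * 2 ^ CARD('n))
       * (emeasure lebesgue U + ennreal ((K powr (\<gamma> - 1)) ^ CARD('n)) * (\<integral>\<^sup>+x\<in>ball x0 r. ennreal (\<bar>f x\<bar> ^ CARD('n)) \<partial>lebesgue))"
proof -
  let ?n = "CARD('n)"
  have N1: "1 \<le> N" unfolding N_def by (rule one_le_card)
  have C: "0 \<le> C" using lam N1 by (simp add: C_def)
  have cb: "cball x0 r \<subseteq> cball 0 1" using closure_mono[OF r(2)] r(1) by simp
  obtain y2 where y2: "y2 \<in> cball 0 1" and
    t2: "\<And>z. z \<in> cball 0 1 \<Longrightarrow> u x2 + K / 2 * (norm (x2 - y2))\<^sup>2 \<le> u z + K / 2 * (norm (z - y2))\<^sup>2"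
    using x2(1) mem_contact_set_iff[OF u] by blast
  define m where "m = u x2 + K / 2 * (norm (x2 - y2))\<^sup>2"
  define G where "G z = - (K / 2 * (norm (z - y2))\<^sup>2)" for z
  have Gc: "continuous_on X G" for X unfolding G_def by (intro continuous_intros)
  have x2r: "norm (x2 - x0) \<le> r / 2" using x2(2) by (simp add: dist_norm norm_minus_commute)
  have Yr: "cball x2 (r / 8) \<subseteq> cball x0 r"
  proof
    fix y assume "y \<in> cball x2 (r / 8)"
    then show "y \<in> cball x0 r"
      using x2r r(1) norm_triangle_ineq[of "y - x2" "x2 - x0"] by (simp add: dist_norm norm_minus_commute)
  qed
  define F where "F y z = u z - G z + K / 2 * (norm (z - y))\<^sup>2" for y z
  have min: "\<exists>x\<in>ball x0 r. \<forall>z\<in>cball 0 1. F y x \<le> F y z" if y: "y \<in> cball x2 (r / 8)" for y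
  proof -
    have "continuous_on (cball x0 r) (F y)" unfolding F_def
      by (intro continuous_intros Gc continuous_on_subset[OF u cb])
    then obtain x where x: "x \<in> cball x0 r" "\<And>z. z \<in> cball x0 r \<Longrightarrow> F y x \<le> F y z"
      using continuous_attains_inf[of "cball x0 r" "F y"] r by auto
    have x2c: "x2 \<in> cball x0 r" using x2r r(1) by (simp add: dist_norm norm_minus_commute)
    have y8: "norm (x2 - y) \<le> r / 8" using y by (simp add: dist_norm)
    then have "(norm (x2 - y))\<^sup>2 \<le> (r / 8)\<^sup>2" by (intro power_mono) auto
    then have F2: "F y x2 \<le> m + K / 2 * (r / 8)\<^sup>2" using K by (simp add: F_def G_def m_def)
    have out: "m + K / 2 * (r / 4)\<^sup>2 \<le> F y z" if z: "z \<in> cball 0 1" "r \<le> norm (z - x0)" for z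
    proof -
      have "norm (z - x0) \<le> norm (z - y) + norm (x2 - y) + norm (x2 - x0)"
        using norm_triangle_ineq[of "z - y" "y - x0"] norm_triangle_ineq[of "y - x2" "x2 - x0"] by (simp add: norm_minus_commute)
      then have "r / 4 \<le> norm (z - y)" using z(2) y8 x2r r(1) by linarith
      then have "(r / 4)\<^sup>2 \<le> (norm (z - y))\<^sup>2" using r(1) by (intro power_mono) auto
      then have "K / 2 * (r / 4)\<^sup>2 \<le> K / 2 * (norm (z - y))\<^sup>2" using K by (intro mult_left_mono) auto
      then show ?thesis using t2[OF z(1)] by (simp add: F_def G_def m_def)
    qed
    have "(r / 8)\<^sup>2 < (r / 4)\<^sup>2" using r(1) by (intro power_strict_mono) auto
    then have "K / 2 * (r / 8)\<^sup>2 < K / 2 * (r / 4)\<^sup>2" using K by (intro mult_strict_left_mono) auto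
    then have xm: "F y x < m + K / 2 * (r / 4)\<^sup>2" using x(2)[OF x2c] F2 by linarith
    show ?thesis
    proof (rule bexI[of _ x])
      show "x \<in> ball x0 r"
      proof (rule ccontr)
        assume "x \<notin> ball x0 r"
        then have "r \<le> norm (x - x0)" by (simp add: dist_norm norm_minus_commute)
        then show False using out[of x] xm x(1) cb by (simp add: subset_iff)
      qed
      show "\<forall>z\<in>cball 0 1. F y x \<le> F y z"
        using x(2) out xm by (force simp: dist_norm norm_minus_commute)
    qed
  qed
  have con: "x \<in> contact_set (2 * K) u"
    if x: "x \<in> ball x0 r" "\<forall>z\<in>cball 0 1. F y x \<le> F y z" and y: "y \<in> cball x2 (r / 8)" for x y
  proof -
    have y': "y \<in> cball 0 1" using y Yr cb by blast
    obtain w c where w: "w \<in> cball 0 1"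
      "\<And>z. K / 2 * (norm (z - y2))\<^sup>2 + K / 2 * (norm (z - y))\<^sup>2 = (K + K) / 2 * (norm (z - w))\<^sup>2 + c"
      using add_paraboloids[of K K y2 y] K y2 y' by auto
    have "u x + 2 * K / 2 * (norm (x - w))\<^sup>2 \<le> u z + 2 * K / 2 * (norm (z - w))\<^sup>2" if z: "z \<in> cball 0 1" for z
    proof -
      have "F y x \<le> F y z" using x(2) z by auto
      then show ?thesis using w(2)[of x] w(2)[of z] by (simp add: F_def G_def)
    qed
    then show ?thesis using mem_contact_set_iff[OF u] w(1) x(1) r(2) by blast
  qed
  define k where "k = (K powr (\<gamma> - 1)) ^ ?n"
  have k: "0 \<le> k" by (simp add: k_def)
  define h where "h x = 2 ^ ?n * (1 + k * \<bar>f x\<bar> ^ ?n)" for x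
  have f': "continuous_on (ball x0 r) f" using f r(2) continuous_on_subset by blast
  define g where "g \<xi> = - K *\<^sub>R (\<xi> - y2)" for \<xi>
  have "emeasure lebesgue (cball x2 (r / 8)) \<le> ennreal (2 * (4 * N * C) ^ ?n) * (\<integral>\<^sup>+x\<in>U. ennreal (h x) \<partial>lebesgue)"
    unfolding N_def C_def
  proof (rule emeasure_vertices_le[OF vis lam \<gamma> f' open_ball r(2), where \<kappa> = K and g = g and G = G and c = 2 and A = "ball x0 r \<inter> contact_set (2 * K) u"])
    show "continuous_on (ball x0 r) u" using u cb ball_subset_cball continuous_on_subset by (metis subset_trans)
    show "continuous_on (ball x0 r) G" by (rule Gc)
    fix x \<xi> assume xi: "x \<in> ball x0 r" "\<xi> \<in> ball x0 r"
    have "(norm (x - y2))\<^sup>2 = (norm (\<xi> - y2))\<^sup>2 + 2 * ((\<xi> - y2) \<bullet> (x - \<xi>)) + (norm (x - \<xi>))\<^sup>2"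
      by (simp add: power2_norm_eq_inner inner_simps inner_commute)
    moreover have "0 \<le> K * (norm (x - \<xi>))\<^sup>2" using K by simp
    ultimately show "G \<xi> + g \<xi> \<bullet> (x - \<xi>) - 2 * K / 2 * (norm (x - \<xi>))\<^sup>2 \<le> G x"
      unfolding g_def G_def inner_scaleR_left inner_minus_left by (simp add: field_simps)
  next
    fix \<xi> assume "\<xi> \<in> ball x0 r"
    then have "\<xi> \<in> ball 0 1" using r(2) by blast
    then have "norm \<xi> \<le> 1" "norm y2 \<le> 1" using y2 by auto
    then have "norm (\<xi> - y2) \<le> 2" using norm_triangle_ineq4[of \<xi> y2] by linarith
    then show "norm (g \<xi>) \<le> 2 * K" using K by (simp add: g_def)
  next
    show "cball x2 (r / 8) \<subseteq> cball 0 1" using Yr cb by blast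
    show "continuous_on (ball x0 r) h" unfolding h_def by (intro continuous_intros f')
    show "open U" "ball x0 r \<inter> contact_set (2 * K) u \<subseteq> U" "U \<subseteq> ball x0 r" "0 < K"
      by (fact U K)+
  next
    fix y assume y: "y \<in> cball x2 (r / 8)"
    then obtain x where x: "x \<in> ball x0 r" "\<forall>z\<in>cball 0 1. F y x \<le> F y z" using min by blast
    have "\<forall>z\<in>ball x0 r. F y x \<le> F y z" using x(2) cb ball_subset_cball by blast
    then show "\<exists>x\<in>ball x0 r \<inter> contact_set (2 * K) u. \<forall>z\<in>ball x0 r.
       u x - G x + K / 2 * (norm (x - y))\<^sup>2 \<le> u z - G z + K / 2 * (norm (z - y))\<^sup>2"
      using con[OF x y] x(1) unfolding F_def by blast
  next
    fix x
    have "(1 + K powr (\<gamma> - 1) * \<bar>f x\<bar>) ^ ?n \<le> 2 ^ ?n * (1 + (K powr (\<gamma> - 1) * \<bar>f x\<bar>) ^ ?n)"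
      by (rule power_one_add_le) simp
    then show "(1 + K powr (\<gamma> - 1) * \<bar>f x\<bar>) ^ ?n \<le> h x"
      by (simp add: h_def k_def power_mult_distrib)
  qed simp
  also have "(\<integral>\<^sup>+x\<in>U. ennreal (h x) \<partial>lebesgue) \<le> ennreal (2 ^ ?n) *
      (emeasure lebesgue U + ennreal k * (\<integral>\<^sup>+x\<in>ball x0 r. ennreal (\<bar>f x\<bar> ^ ?n) \<partial>lebesgue))"
  proof -
    have fU: "continuous_on U f" using f' U(3) continuous_on_subset by blast
    note fm = set_nn_integral_measurable[OF U(1) fU]
    have "ennreal (h x) = ennreal (2 ^ ?n) * (1 + ennreal k * ennreal (\<bar>f x\<bar> ^ ?n))" for x
    proof -
      have "ennreal (1 + k * \<bar>f x\<bar> ^ ?n) = 1 + ennreal k * ennreal (\<bar>f x\<bar> ^ ?n)"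
        using k by (simp add: ennreal_plus ennreal_mult)
      then show ?thesis using k by (simp add: h_def ennreal_mult)
    qed
    then have "(\<integral>\<^sup>+x\<in>U. ennreal (h x) \<partial>lebesgue)
        = (\<integral>\<^sup>+x. ennreal (2 ^ ?n) * (indicator U x + ennreal k * (ennreal (\<bar>f x\<bar> ^ ?n) * indicator U x)) \<partial>lebesgue)"
      by (intro nn_integral_cong) (simp add: indicator_def)
    also have "\<dots> = ennreal (2 ^ ?n) * (emeasure lebesgue U + ennreal k * (\<integral>\<^sup>+x\<in>U. ennreal (\<bar>f x\<bar> ^ ?n) \<partial>lebesgue))"
    proof -
      let ?F = "\<lambda>x. ennreal (\<bar>f x\<bar> ^ ?n) * indicator U x"
      have mU: "(indicator U :: real^'n \<Rightarrow> ennreal) \<in> borel_measurable lebesgue"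
        using U(1) by (intro borel_measurable_indicator) auto
      have mF: "(\<lambda>x. ennreal k * ?F x) \<in> borel_measurable lebesgue" 
        by (rule borel_measurable_times_ennreal[OF borel_measurable_const fm])
      have "(\<integral>\<^sup>+x. indicator U x + ennreal k * ?F x \<partial>lebesgue) = emeasure lebesgue U + ennreal k * (\<integral>\<^sup>+x. ?F x \<partial>lebesgue)"
        using nn_integral_add[OF mU mF] nn_integral_cmult[OF fm, of "ennreal k" ?n] U(1) by (simp only:) simp
      then show ?thesis
        using nn_integral_cmult[OF borel_measurable_add[OF mU mF], of "ennreal (2 ^ ?n)"] by (simp only:)
    qed
    also have "(\<integral>\<^sup>+x\<in>U. ennreal (\<bar>f x\<bar> ^ ?n) \<partial>lebesgue) \<le> (\<integral>\<^sup>+x\<in>ball x0 r. ennreal (\<bar>f x\<bar> ^ ?n) \<partial>lebesgue)"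
      using U(3) by (intro nn_integral_mono) (auto simp: indicator_def)
    finally show ?thesis by (simp add: mult_left_mono add_left_mono)
  qed
  finally show ?thesis
    using C N1 unfolding k_def by (simp add: ennreal_mult mult.assoc mult_left_mono)
qed

text \<open>The measure estimate with constants: as the contact set is Borel, it can be approximated by open
  sets from outside. The smallness condition says that the source takes up at most half of the measure
  \<open>(r / 8)\<^sup>n\<close> of the vertex ball.\<close>

lemma contact_set_density:
  fixes lam Lam :: real
  defines "N \<equiv> real CARD('n)"
  defines "D \<equiv> 2 * (4 * N * (16 / lam * (3 * Lam * N * (2 + 1) + 2 + 4))) ^ CARD('n) * 2 ^ CARD('n)"
  fixes K :: real and u f :: "real^'n \<Rightarrow> real"
  assumes vis: "viscosity_supersol lam Lam \<gamma> f u" and lam: "0 < lam" "lam \<le> Lam"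
    and \<gamma>: "0 \<le> \<gamma>" "\<gamma> < 1" and f: "continuous_on (ball 0 1) f" and u: "continuous_on (cball 0 1) u"
    and K: "0 < K" and r: "0 < r" "ball x0 r \<subseteq> ball 0 1"
    and x2: "x2 \<in> contact_set K u" "x2 \<in> cball x0 (r / 2)"
    and small: "(\<integral>\<^sup>+x\<in>ball x0 r. ennreal (\<bar>f x\<bar> ^ CARD('n)) \<partial>lebesgue) \<le> ennreal I"
      "(K powr (\<gamma> - 1)) ^ CARD('n) * I \<le> (1 / 8) ^ CARD('n) / (2 * D) * measure lebesgue (ball x0 r)" "0 \<le> I"
  shows "(1 / 8) ^ CARD('n) / (2 * D) * measure lebesgue (ball x0 r) \<le> measure lebesgue (ball x0 r \<inter> contact_set (2 * K) u)"
proof (rule field_le_epsilon)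
  let ?n = "CARD('n)"
  let ?T = "ball x0 r \<inter> contact_set (2 * K) u"
  let ?b = "measure lebesgue (ball x0 r)"
  fix e :: real assume e: "0 < e"
  have N1: "1 \<le> N" unfolding N_def by (rule one_le_card)
  have "0 < 16 / lam * (3 * Lam * N * (2 + 1) + 2 + 4)" using lam N1 by (intro mult_pos_pos add_nonneg_pos) auto
  moreover have "0 < 2 * (4 * N * q) ^ ?n * 2 ^ ?n" if "0 < q" for q
    using N1 that by (intro mult_pos_pos zero_less_power) auto
  ultimately have D: "0 < D" unfolding D_def by blast
  have T: "?T \<in> lmeasurable"
    by (rule bounded_set_imp_lmeasurable) (use contact_set_borel[OF u] in \<open>auto intro: bounded_Int\<close>)
  obtain V where V: "open V" "?T \<subseteq> V" "V - ?T \<in> lmeasurable" "emeasure lebesgue (V - ?T) < ennreal e"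
    using sets_lebesgue_outer_open[OF fmeasurableD[OF T] e] by metis
  define U where "U = V \<inter> ball x0 r"
  have U: "open U" "?T \<subseteq> U" "U \<subseteq> ball x0 r" using V by (auto simp: U_def)
  have Um: "U \<in> lmeasurable" using U by (intro lmeasurable_open bounded_subset[OF bounded_ball]) auto
  have "measure lebesgue (U - ?T) \<le> measure lebesgue (V - ?T)"
    using V Um T by (intro measure_mono_fmeasurable) (auto simp: U_def)
  also have "\<dots> \<le> e" using V(3,4) e by (simp add: emeasure_eq_measure2 ennreal_less_iff less_imp_le)
  finally have Ue: "measure lebesgue U \<le> measure lebesgue ?T + e"
    using measurable_measure_Diff[OF Um fmeasurableD[OF T] U(2)] by simp
  have Y: "emeasure lebesgue (cball x2 (r / 8)) = ennreal ((1 / 8) ^ ?n * ?b)"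
    using r(1) by (simp add: emeasure_cball measure_completion content_ball power_divide mult_ac)
  have kn: "0 \<le> (K powr (\<gamma> - 1)) ^ ?n" by simp
  have "emeasure lebesgue (cball x2 (r / 8)) \<le> ennreal D
       * (emeasure lebesgue U + ennreal ((K powr (\<gamma> - 1)) ^ ?n) * (\<integral>\<^sup>+x\<in>ball x0 r. ennreal (\<bar>f x\<bar> ^ ?n) \<partial>lebesgue))"
    unfolding D_def N_def by (rule contact_set_spreads[OF vis lam \<gamma> f u K r x2 U])
  also have "\<dots> \<le> ennreal D * (emeasure lebesgue U + ennreal ((K powr (\<gamma> - 1)) ^ ?n) * ennreal I)"
    by (intro mult_left_mono add_left_mono small) auto
  also have "\<dots> = ennreal (D * (measure lebesgue U + (K powr (\<gamma> - 1)) ^ ?n * I))"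
    using Um D small(3) kn by (simp add: emeasure_eq_measure2 ennreal_mult ennreal_plus)
  finally have "(1 / 8) ^ ?n * ?b \<le> D * (measure lebesgue U + (K powr (\<gamma> - 1)) ^ ?n * I)"
    unfolding Y using D small(3) by (subst (asm) ennreal_le_iff) auto
  also have "\<dots> \<le> D * (measure lebesgue U + (1 / 8) ^ ?n / (2 * D) * ?b)"
    using D small(2) by (intro mult_left_mono add_left_mono) auto
  also have "\<dots> = D * measure lebesgue U + (1 / 8) ^ ?n * ?b / 2" using D by (simp add: field_simps)
  finally have "(1 / 8) ^ ?n * ?b / 2 \<le> D * measure lebesgue U" by simp
  then have "(1 / 8) ^ ?n / (2 * D) * ?b \<le> measure lebesgue U" using D by (simp add: field_simps)
  then show "(1 / 8) ^ ?n / (2 * D) * ?b \<le> measure lebesgue ?T + e" using Ue by linarith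
qed

section \<open>Density and the maximal function\<close>

text \<open>\<open>ball x0 r \<subseteq> ball x (2 r)\<close>, and the latter occurs in the supremum.\<close>

lemma set_nn_integral_le_maximal_fun:
  fixes g :: "real^'n \<Rightarrow> real"
  assumes M: "maximal_fun g x \<le> ennreal q" and q: "0 \<le> q" and r: "0 < r" "ball x0 r \<subseteq> ball 0 1" and x: "x \<in> ball x0 r"
  shows "(\<integral>\<^sup>+y\<in>ball x0 r. ennreal \<bar>g y\<bar> \<partial>lebesgue) \<le> ennreal (q * 2 ^ CARD('n) * measure lebesgue (ball x0 r))"
proof -
  let ?B = "ball x (2 * r)"
  let ?I = "\<integral>\<^sup>+y\<in>?B \<inter> ball 0 1. ennreal \<bar>g y\<bar> \<partial>lebesgue"
  have e: "emeasure lebesgue ?B = ennreal (2 ^ CARD('n) * measure lebesgue (ball x0 r))"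
    using r(1) by (simp add: emeasure_ball measure_completion content_ball power_mult_distrib mult_ac)
  have e0: "emeasure lebesgue ?B \<noteq> 0" "emeasure lebesgue ?B \<noteq> top"
    unfolding e using r(1) by (simp_all add: measure_completion content_ball ennreal_eq_0_iff not_le)
  have "ball x0 r \<subseteq> ?B"
  proof
    fix y assume "y \<in> ball x0 r"
    then show "y \<in> ?B" using x dist_triangle2[of x y x0] by (simp add: dist_commute)
  qed
  then have "ball x0 r \<subseteq> ?B \<inter> ball 0 1" using r by auto
  then have "(\<integral>\<^sup>+y\<in>ball x0 r. ennreal \<bar>g y\<bar> \<partial>lebesgue) \<le> ?I"
    by (intro nn_integral_mono) (auto simp: indicator_def)
  also have "?I = ?I * emeasure lebesgue ?B / emeasure lebesgue ?B"
    by (rule ennreal_mult_divide_eq[OF e0, symmetric])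
  also have "\<dots> = ?I / emeasure lebesgue ?B * emeasure lebesgue ?B"
    by (simp only: ennreal_divide_times ennreal_times_divide)
  also have "\<dots> \<le> ennreal q * emeasure lebesgue ?B"
  proof (rule mult_right_mono)
    have "?I / emeasure lebesgue ?B \<le> maximal_fun g x"
      unfolding maximal_fun_def using r(1) by (intro SUP_upper2[of "2 * r"]) auto
    then show "?I / emeasure lebesgue ?B \<le> ennreal q" using M by simp
  qed simp
  also have "\<dots> = ennreal (q * 2 ^ CARD('n) * measure lebesgue (ball x0 r))"
    unfolding e using q by (simp add: ennreal_mult[symmetric] mult.assoc)
  finally show ?thesis .
qed

text \<open>By Bernoulli's inequality the annulus outside the smaller ball has at most the fraction \<open>\<theta> / 2\<close> of
  the volume. A nonmeasurable \<open>S\<close> has \<open>measure\<close> zero, which the density condition excludes.\<close>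

lemma dense_set_meets_smaller_ball:
  fixes S :: "(real^'n) set"
  assumes S: "S \<subseteq> ball x0 r" "\<theta> * measure lebesgue (ball x0 r) \<le> measure lebesgue S"
    and \<theta>: "0 < \<theta>" "\<theta> < 1" and r: "0 < r"
  obtains x where "x \<in> S" "norm (x - x0) \<le> (1 - \<theta> / (2 * real CARD('n))) * r"
proof -
  let ?n = "CARD('n)"
  define \<delta> where "\<delta> = \<theta> / (2 * real ?n)"
  have n1: "1 \<le> real ?n" by (rule one_le_card)
  have "0 < \<theta> / (2 * m) \<and> \<theta> / (2 * m) < 1" if "1 \<le> m" for m
    using \<theta> that by (simp add: divide_less_eq)
  from this[OF n1] have \<delta>: "0 < \<delta>" "\<delta> < 1" unfolding \<delta>_def by blast+
  have B: "measure lebesgue (ball x0 r) = unit_ball_vol (real ?n) * r ^ ?n" (is "_ = ?w")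
    using r by (simp add: measure_completion content_ball)
  have w: "0 < ?w" using r by simp
  have "\<exists>x\<in>S. norm (x - x0) \<le> (1 - \<delta>) * r"
  proof (rule ccontr)
    assume "\<not> ?thesis"
    then have sub: "S \<subseteq> ball x0 r - cball x0 ((1 - \<delta>) * r)"
      using S(1) by (force simp: dist_norm norm_minus_commute)
    have inner: "cball x0 ((1 - \<delta>) * r) \<subseteq> ball x0 r" 
  proof
    fix x assume "x \<in> cball x0 ((1 - \<delta>) * r)"
    moreover have "(1 - \<delta>) * r < 1 * r" using \<delta> r by (intro mult_strict_right_mono) auto
    ultimately show "x \<in> ball x0 r" by simp
  qed
    have "measure lebesgue S \<le> measure lebesgue (ball x0 r - cball x0 ((1 - \<delta>) * r))"
    proof (cases "S \<in> sets lebesgue")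
      case True
      then show ?thesis using sub by (intro measure_mono_fmeasurable fmeasurable_Diff) auto
    next
      case False
      then show ?thesis by (simp add: measure_notin_sets)
    qed
    also have "\<dots> = measure lebesgue (ball x0 r) - measure lebesgue (cball x0 ((1 - \<delta>) * r))"
      by (rule measurable_measure_Diff) (use inner in auto)
    also have "\<dots> = ?w - ?w * (1 - \<delta>) ^ ?n"
      unfolding B using \<delta> r by (simp add: measure_completion content_cball power_mult_distrib mult_ac)
    also have "\<dots> \<le> ?w * (\<theta> / 2)"
    proof -
      have "1 + real ?n * (- \<delta>) \<le> (1 + (- \<delta>)) ^ ?n"
        using \<delta> by (intro Bernoulli_inequality) auto
      then have "1 - (1 - \<delta>) ^ ?n \<le> \<theta> / 2" using n1 by (simp add: \<delta>_def)
      then have "?w * (1 - (1 - \<delta>) ^ ?n) \<le> ?w * (\<theta> / 2)" using w by (intro mult_left_mono) auto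
      then show ?thesis by (simp add: algebra_simps)
    qed
    also have "\<dots> < ?w * \<theta>" using w \<theta> by (intro mult_strict_left_mono) auto
    finally show False using S(2) unfolding B by (simp add: mult.commute)
  qed
  then show ?thesis using that unfolding \<delta>_def by blast
qed

section \<open>Measure estimate for the contact sets\<close>

theorem lemma3p2:
  fixes lam Lam :: real
  assumes "0 < lam" and "lam \<le> Lam"
  shows "\<exists>M \<Theta>. 1 < M \<and> 0 < \<Theta> \<and> \<Theta> < 1 \<and>
    (\<forall>\<theta>0. 0 < \<theta>0 \<and> \<theta>0 < 1 \<longrightarrow>
      (\<exists>\<epsilon>2 \<theta>. 0 < \<epsilon>2 \<and> 0 < \<theta> \<and> \<theta> < min \<theta>0 \<Theta> \<and>
        (\<forall>\<gamma> K (f :: real^'n \<Rightarrow> real) (u :: real^'n \<Rightarrow> real) x0 r.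
           0 \<le> \<gamma> \<longrightarrow> \<gamma> < 1 \<longrightarrow> 1 \<le> K \<longrightarrow>
           continuous_on (ball 0 1) f \<longrightarrow>
           set_integrable lebesgue (ball 0 1) (\<lambda>x. \<bar>f x\<bar> ^ CARD('n)) \<longrightarrow>
           continuous_on (cball 0 1) u \<longrightarrow>
           viscosity_supersol lam Lam \<gamma> f u \<longrightarrow>
           0 < r \<longrightarrow> ball x0 r \<subseteq> ball 0 1 \<longrightarrow>
           measure lebesgue (ball x0 r \<inter> contact_set K u \<inter>
               {x \<in> ball 0 1. maximal_fun (\<lambda>y. \<bar>f y\<bar> ^ CARD('n)) x
                              \<le> ennreal (\<epsilon>2 * K powr ((1 - \<gamma>) * real CARD('n)))})
             \<ge> \<theta> * measure lebesgue (ball x0 r) \<longrightarrow>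
           measure lebesgue (ball x0 r \<inter> contact_set (K * M) u)
             \<ge> \<Theta> * measure lebesgue (ball x0 r))))"
proof -
  let ?n = "CARD('n)"
  define N where "N = real ?n"
  have N1: "1 \<le> N" unfolding N_def by (rule one_le_card)
  define \<beta> where "\<beta> = 4 * (12 * Lam * N + 3) / lam"
  define s where "s = (6 * Lam * N + 5) * exp \<beta>"
  define D where "D = 2 * (4 * N * (16 / lam * (3 * Lam * N * (2 + 1) + 2 + 4))) ^ ?n * 2 ^ ?n"
  have s: "0 < s" using assms N1 by (simp add: s_def add_nonneg_pos)
  have "0 < 16 / lam * (3 * Lam * N * (2 + 1) + 2 + 4)" using assms N1 by (intro mult_pos_pos add_nonneg_pos) auto
  moreover have "0 < 2 * (4 * N * q) ^ ?n * 2 ^ ?n" if "0 < q" for q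
    using N1 that by (intro mult_pos_pos zero_less_power) auto
  ultimately have D: "0 < D" unfolding D_def by blast
  define \<eta> where "\<eta> = (1 / 8) ^ ?n / (2 * D)"
  have \<eta>: "0 < \<eta>" using D by (simp add: \<eta>_def)
  define M where "M = 2 * (2 + 2 * s)"
  define \<Theta> where "\<Theta> = min \<eta> (1 / 2)"
  have \<Theta>: "0 < \<Theta>" "\<Theta> < 1" "\<Theta> \<le> \<eta>" using \<eta> by (auto simp: \<Theta>_def)
  have main: "\<exists>\<epsilon>2 \<theta>. 0 < \<epsilon>2 \<and> 0 < \<theta> \<and> \<theta> < min \<theta>0 \<Theta> \<and>
        (\<forall>\<gamma> K (f :: real^'n \<Rightarrow> real) (u :: real^'n \<Rightarrow> real) x0 r.
           0 \<le> \<gamma> \<longrightarrow> \<gamma> < 1 \<longrightarrow> 1 \<le> K \<longrightarrow>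
           continuous_on (ball 0 1) f \<longrightarrow>
           set_integrable lebesgue (ball 0 1) (\<lambda>x. \<bar>f x\<bar> ^ CARD('n)) \<longrightarrow>
           continuous_on (cball 0 1) u \<longrightarrow>
           viscosity_supersol lam Lam \<gamma> f u \<longrightarrow>
           0 < r \<longrightarrow> ball x0 r \<subseteq> ball 0 1 \<longrightarrow>
           measure lebesgue (ball x0 r \<inter> contact_set K u \<inter>
               {x \<in> ball 0 1. maximal_fun (\<lambda>y. \<bar>f y\<bar> ^ CARD('n)) x
                              \<le> ennreal (\<epsilon>2 * K powr ((1 - \<gamma>) * real CARD('n)))})
             \<ge> \<theta> * measure lebesgue (ball x0 r) \<longrightarrow>
           measure lebesgue (ball x0 r \<inter> contact_set (K * M) u)
             \<ge> \<Theta> * measure lebesgue (ball x0 r))"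
    if \<theta>0: "0 < \<theta>0" "\<theta>0 < 1" for \<theta>0
  proof -
    \<comment> \<open>\<open>\<theta>\<close> only determines how close to the boundary of the ball the given contact point may be;
      \<open>\<epsilon>2\<close> absorbs the loss, while the barrier, and with it \<open>M\<close> and \<open>\<Theta>\<close>, stays the same.\<close>
    define \<theta> where "\<theta> = min \<theta>0 \<Theta> / 2"
    have \<theta>: "0 < \<theta>" "\<theta> < min \<theta>0 \<Theta>" "\<theta> < 1"
      using \<theta>0 \<Theta> by (auto simp: \<theta>_def min_def)
    define \<delta> where "\<delta> = \<theta> / (2 * N)"
    then have \<delta>_eq: "\<delta> = \<theta> / (2 * real ?n)" by (simp only: N_def)
    have "\<theta> < 2 * N" using \<theta> N1 by linarith
    then have \<delta>: "0 < \<delta>" "\<delta> < 1" using \<theta> N1 by (auto simp: \<delta>_def)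
    define c where "c = 4 * (4 + 2 * s) / \<delta>"
    define P where "P = 2 * (4 * N * (16 / lam * (3 * Lam * N * (c + 1) + c + 4))) ^ ?n * (4 + 2 * s + 4 / \<delta>) ^ ?n"
    have c: "0 < c" using s \<delta> by (simp add: c_def)
    have P: "0 \<le> P" unfolding P_def using c s \<delta> N1 assms
      by (intro mult_nonneg_nonneg zero_le_power add_nonneg_nonneg divide_nonneg_nonneg) auto
    \<comment> \<open>The first bound serves the spreading step, the second one the barrier step.\<close>
    define \<epsilon>2 where "\<epsilon>2 = min (\<eta> / 2 ^ ?n) (1 / ((P + 1) * 2 ^ ?n))"
    have \<epsilon>2: "0 < \<epsilon>2" using \<eta> P by (simp add: \<epsilon>2_def add_nonneg_pos)
    have \<epsilon>\<eta>: "\<epsilon>2 * 2 ^ ?n \<le> \<eta>"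
    proof -
      have "\<epsilon>2 \<le> \<eta> / 2 ^ ?n" by (simp add: \<epsilon>2_def)
      then show ?thesis by (simp add: field_simps)
    qed
    have \<epsilon>P: "P * (\<epsilon>2 * 2 ^ ?n) < 1"
    proof -
      have "\<epsilon>2 \<le> 1 / ((P + 1) * 2 ^ ?n)" by (simp add: \<epsilon>2_def)
      moreover have "0 < (P + 1) * 2 ^ ?n" using P by simp
      ultimately have "\<epsilon>2 * ((P + 1) * 2 ^ ?n) \<le> 1" using pos_le_divide_eq by blast
      then have "(P + 1) * (\<epsilon>2 * 2 ^ ?n) \<le> 1" by (simp only: mult_ac)
      moreover have "0 < \<epsilon>2 * 2 ^ ?n" using \<epsilon>2 by simp
      ultimately show ?thesis by (simp add: distrib_right)
    qed
    have "\<Theta> * measure lebesgue (ball x0 r) \<le> measure lebesgue (ball x0 r \<inter> contact_set (K * M) u)"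
      if \<gamma>: "0 \<le> \<gamma>" "\<gamma> < 1" and K: "1 \<le> K" and f: "continuous_on (ball 0 1) f" and u: "continuous_on (cball 0 1) u"
        and vis: "viscosity_supersol lam Lam \<gamma> f u" and r: "0 < r" "ball x0 r \<subseteq> ball 0 1"
        and dense: "\<theta> * measure lebesgue (ball x0 r) \<le> measure lebesgue (ball x0 r \<inter> contact_set K u \<inter>
               {x \<in> ball 0 1. maximal_fun (\<lambda>y. \<bar>f y\<bar> ^ CARD('n)) x
                              \<le> ennreal (\<epsilon>2 * K powr ((1 - \<gamma>) * real CARD('n)))})"
      for \<gamma> K x0 r and f u :: "real^'n \<Rightarrow> real"
    proof -
      let ?S = "ball x0 r \<inter> contact_set K u \<inter> {x \<in> ball 0 1. maximal_fun (\<lambda>y. \<bar>f y\<bar> ^ CARD('n)) x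
                              \<le> ennreal (\<epsilon>2 * K powr ((1 - \<gamma>) * real CARD('n)))}"
      let ?b = "measure lebesgue (ball x0 r)"
      have b: "0 < ?b" using r(1) by (simp add: measure_completion content_ball)
      have Sb: "?S \<subseteq> ball x0 r" by blast
      obtain x1 where "x1 \<in> ?S" and x1d: "norm (x1 - x0) \<le> (1 - \<delta>) * r"
        by (rule dense_set_meets_smaller_ball[OF Sb dense \<theta>(1,3) r(1), folded \<delta>_eq])
      then have x1: "x1 \<in> ball x0 r" "x1 \<in> contact_set K u"
        and mx: "maximal_fun (\<lambda>y. \<bar>f y\<bar> ^ ?n) x1 \<le> ennreal (\<epsilon>2 * K powr ((1 - \<gamma>) * real ?n))"
          by auto
      define I where "I = \<epsilon>2 * K powr ((1 - \<gamma>) * real ?n) * 2 ^ ?n * ?b"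
      have I0: "0 \<le> I" using \<epsilon>2 b by (simp add: I_def)
      have I: "(\<integral>\<^sup>+x\<in>ball x0 r. ennreal (\<bar>f x\<bar> ^ ?n) \<partial>lebesgue) \<le> ennreal I"
        using set_nn_integral_le_maximal_fun[OF mx _ r x1(1)] \<epsilon>2 by (simp add: I_def)
      have KI: "(K powr (\<gamma> - 1)) ^ ?n * I = \<epsilon>2 * 2 ^ ?n * ?b"
      proof -
        have "(K powr (\<gamma> - 1)) ^ ?n * K powr ((1 - \<gamma>) * real ?n) = 1"
          using K by (simp add: powr_power powr_add[symmetric] algebra_simps)
        then show ?thesis by (simp add: I_def)
      qed
      have "cball x0 (r / 2) \<inter> contact_set (K * (2 + 2 * s)) u \<noteq> {}"
      proof
        assume none: "cball x0 (r / 2) \<inter> contact_set (K * (2 + 2 * s)) u = {}"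
        have K0: "0 < K" using K by simp
        have "emeasure lebesgue (cball x0 r) \<le> ennreal (P * (K powr (\<gamma> - 1)) ^ ?n) * (\<integral>\<^sup>+x\<in>ball x0 r. ennreal (\<bar>f x\<bar> ^ ?n) \<partial>lebesgue)"
          using contact_point_or_large_source[OF vis assms \<gamma> f u K0 \<delta> r x1(2) x1d,
              folded N_def, folded \<beta>_def, folded s_def, folded c_def, folded P_def] none
          by (simp add: mult.assoc)
        also have "\<dots> \<le> ennreal (P * (K powr (\<gamma> - 1)) ^ ?n) * ennreal I"
          by (intro mult_left_mono I) auto
        also have "\<dots> = ennreal (P * ((K powr (\<gamma> - 1)) ^ ?n * I))"
          using P I0 by (simp add: ennreal_mult[symmetric] mult.assoc)
        also have "\<dots> = ennreal (P * (\<epsilon>2 * 2 ^ ?n) * ?b)" unfolding KI by (simp add: mult.assoc)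
        finally have "ennreal ?b \<le> ennreal (P * (\<epsilon>2 * 2 ^ ?n) * ?b)"
          using r(1) by (simp add: emeasure_cball measure_completion content_ball)
        then have "?b \<le> P * (\<epsilon>2 * 2 ^ ?n) * ?b" using P \<epsilon>2 b by (subst (asm) ennreal_le_iff) auto
        also have "\<dots> < 1 * ?b" using \<epsilon>P b by (intro mult_strict_right_mono) auto
        finally show False by simp
      qed
      then obtain x2 where x2: "x2 \<in> contact_set (K * (2 + 2 * s)) u" "x2 \<in> cball x0 (r / 2)" by blast
      let ?K = "K * (2 + 2 * s)"
      have KK: "K \<le> ?K" using mult_left_mono[of 1 "2 + 2 * s" K] K s by simp
      then have K0: "0 < ?K" using K by linarith
      have "?K powr (\<gamma> - 1) \<le> K powr (\<gamma> - 1)" using KK K \<gamma> by (intro powr_mono2') auto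
      then have "(?K powr (\<gamma> - 1)) ^ ?n * I \<le> (K powr (\<gamma> - 1)) ^ ?n * I"
        using I0 by (intro mult_right_mono power_mono) auto
      also have "\<dots> \<le> \<eta> * ?b" unfolding KI using \<epsilon>\<eta> b by (intro mult_right_mono) auto
      finally have small: "(?K powr (\<gamma> - 1)) ^ ?n * I \<le> \<eta> * ?b" .
      have "\<Theta> * ?b \<le> \<eta> * ?b" using \<Theta> b by (intro mult_right_mono) auto
      also have "\<eta> * ?b \<le> measure lebesgue (ball x0 r \<inter> contact_set (2 * ?K) u)"
        using contact_set_density[OF vis assms \<gamma> f u K0 r x2 I _ I0, folded N_def, folded D_def, folded \<eta>_def] small
        by blast
      also have "2 * ?K = K * M" by (simp add: M_def)
      finally show ?thesis .
    qed
    then show ?thesis using \<epsilon>2 \<theta>(1,2) by (intro exI[of _ \<epsilon>2] exI[of _ \<theta>]) blast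
  qed
  show ?thesis using \<Theta>(1,2) s main by (intro exI[of _ M] exI[of _ \<Theta>]) (auto simp: M_def)
qed

end
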